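(* Consider the nonlinear atom+field system described in the context, with $q>0$, and assume $\hbar(\omega_2-\omega_1-\omega)+\epsilon_2^2-\epsilon_1^2=0$. Let $n\ge1$ be an integer and let $t\mapsto\psi(t)$ be a solution of the nonlinear Schrödinger equation whose initial state has norm one and whose only nonvanishing component is $\psi_{1n}(0)$ (atom in level $1$, $n$ photons), so that the atomic inversion $w(t)=2\langle\psi(t)|R_3|\psi(t)\rangle$ has $w(0)=-1$. Put $\Omega=q\sqrt n$ and $\varsigma=(\epsilon_2-\epsilon_1)^2/(2\hbar)$. Then $w$ satisfies $$\ddot w=(2\varsigma^2-\Omega^2)w-2\varsigma^2w^3$$ and $$w(t)=\begin{cases}-\operatorname{cn}(\Omega t,\varsigma/\Omega)&\text{if }\Omega>\varsigma,\\-\operatorname{sech}(\Omega t)&\text{if }\Omega=\varsigma,\\-\operatorname{dn}(\varsigma t,\Omega/\varsigma)&\text{if }\Omega<\varsigma.\end{cases}$$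
   Context: Setting. The atom has levels $k=1,2,\dots,K$ ($K\ge 2$) with real frequencies $\omega_k$ and real nonlinearity parameters $\epsilon_k$. The field is a single mode of frequency $\omega$ with annihilation and creation operators $a,a^\dagger$, where $a|n\rangle=\sqrt n\,|n-1\rangle$. The constants $\hbar>0$ and $q\in\mathbb R$ are given. A state of the composite system is $|\psi\rangle=\sum_{k,n}\psi_{kn}|k\rangle|n\rangle$, with $k$ the atomic level and $n=0,1,2,\dots$ the photon number. The operators $b_k,b_k^\dagger$ are the atomic annihilation and creation operators; on these (one-excitation) states $b_k^\dagger b_l$ acts as $|k\rangle\langle l|\otimes\mathbf 1$. Put $R_3=\tfrac12(b_2^\dagger b_2-b_1^\dagger b_1)$. The Hamiltonian function, in which the atomic nonlinearity depends only on the atom's reduced density matrix, is $$H(\psi,\bar\psi)=\langle\psi|\sum_k\hbar\omega_k b_k^\dagger b_k+\hbar\omega a^\dagger a+\tfrac{i\hbar q}{2}(b_2^\dagger b_1a-a^\dagger b_1^\dagger b_2)|\psi\rangle+\frac{\langle\psi|\sum_k\epsilon_kb_k^\dagger b_k|\psi\rangle^2}{\langle\psi|\psi\rangle}.$$ The nonlinear Schrödinger equation is $i\hbar\,\dot\psi_{kn}=\partial H/\partial\bar\psi_{kn}$. Explicitly, with $E=\sum_{lm}\epsilon_l|\psi_{lm}|^2\big/\sum_{lm}|\psi_{lm}|^2$, $$i\hbar\dot\psi_{1n}=\{\hbar\omega_1+2E\epsilon_1-E^2+n\hbar\omega\}\psi_{1n}-\tfrac i2\hbar q\sqrt n\,\psi_{2,n-1},$$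 $$i\hbar\dot\psi_{2n}=\{\hbar\omega_2+2E\epsilon_2-E^2+n\hbar\omega\}\psi_{2n}+\tfrac i2\hbar q\sqrt{n+1}\,\psi_{1,n+1},$$ $$i\hbar\dot\psi_{kn}=\{\hbar\omega_k+2E\epsilon_k-E^2+n\hbar\omega\}\psi_{kn}\quad(k>2).$$ $\operatorname{cn}(u,\kappa)$ and $\operatorname{dn}(u,\kappa)$ are the Jacobi elliptic functions with modulus $\kappa$; e.g. $y=\operatorname{cn}(u,\kappa)$ satisfies $y'^2=(1-y^2)(1-\kappa^2+\kappa^2y^2)$, $y(0)=1$. *)

theory Defs
  imports "HOL-Analysis.Analysis"
begin

section \<open>States and operators of the atom+field system\<close>

text \<open>
  A state is given by its components: \<open>\<psi> k n\<close> is the coefficient of \<open>|k\<rangle>|n\<rangle>\<close>, with the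
  atomic level \<open>k\<close> ranging over \<open>{1..K}\<close> and the photon number \<open>n\<close> over all naturals.
  Components with \<open>k\<close> outside \<open>{1..K}\<close> carry no meaning and are never constrained.
\<close>

type_synonym state = "nat \<Rightarrow> nat \<Rightarrow> complex"

definition braket :: "nat \<Rightarrow> state \<Rightarrow> state \<Rightarrow> complex" where
  "braket K \<phi> \<psi> = (\<Sum>k\<in>{1..K}. \<Sum>\<^sub>\<infinity>n. cnj (\<phi> k n) * \<psi> k n)"

definition annih :: "state \<Rightarrow> state" where
  "annih \<psi> = (\<lambda>k n. of_real (sqrt (real (Suc n))) * \<psi> k (Suc n))"

definition creat :: "state \<Rightarrow> state" where
  "creat \<psi> = (\<lambda>k n. of_real (sqrt (real n)) * \<psi> k (n - 1))"

text \<open>\<open>bb k l\<close> is the operator \<open>b\<^sub>k\<^sup>\<dagger> b\<^sub>l\<close>, i.e. \<open>|k\<rangle>\<langle>l| \<otimes> 1\<close>.\<close>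

definition bb :: "nat \<Rightarrow> nat \<Rightarrow> state \<Rightarrow> state" where
  "bb k l \<psi> = (\<lambda>j n. if j = k then \<psi> l n else 0)"

definition R3 :: "state \<Rightarrow> state" where
  "R3 \<psi> = (\<lambda>j n. (bb 2 2 \<psi> j n - bb 1 1 \<psi> j n) / 2)"

definition inversion :: "nat \<Rightarrow> state \<Rightarrow> real" where
  "inversion K \<psi> = Re (2 * braket K \<psi> (R3 \<psi>))"


section \<open>The Hamiltonian function\<close>

text \<open>
  Throughout, \<open>hb\<close> is the reduced Planck constant, \<open>\<omega> k\<close> are the atomic frequencies,
  \<open>\<omega>f\<close> is the frequency of the field mode, \<open>q\<close> is the coupling constant and \<open>\<epsilon> k\<close> are the
  nonlinearity parameters.
\<close>

definition H_lin ::
  "nat \<Rightarrow> real \<Rightarrow> (nat \<Rightarrow> real) \<Rightarrow> real \<Rightarrow> real \<Rightarrow> state \<Rightarrow> state" where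
  "H_lin K hb \<omega> \<omega>f q \<psi> = (\<lambda>j n.
      (\<Sum>k\<in>{1..K}. of_real (hb * \<omega> k) * bb k k \<psi> j n)
    + of_real (hb * \<omega>f) * creat (annih \<psi>) j n
    + \<i> * of_real (hb * q) / 2 * (bb 2 1 (annih \<psi>) j n - creat (bb 1 2 \<psi>) j n))"

definition eps_op :: "nat \<Rightarrow> (nat \<Rightarrow> real) \<Rightarrow> state \<Rightarrow> state" where
  "eps_op K \<epsilon> \<psi> = (\<lambda>j n. \<Sum>k\<in>{1..K}. of_real (\<epsilon> k) * bb k k \<psi> j n)"

definition H_fun ::
  "nat \<Rightarrow> real \<Rightarrow> (nat \<Rightarrow> real) \<Rightarrow> real \<Rightarrow> real \<Rightarrow> (nat \<Rightarrow> real) \<Rightarrow> state \<Rightarrow> complex" where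
  "H_fun K hb \<omega> \<omega>f q \<epsilon> \<psi> =
     braket K \<psi> (H_lin K hb \<omega> \<omega>f q \<psi>) + (braket K \<psi> (eps_op K \<epsilon> \<psi>))\<^sup>2 / braket K \<psi> \<psi>"

text \<open>
  The states on which \<open>H_fun\<close> is defined: nonzero, square summable, with finite mean photon number
  (so that every infinite sum in \<open>H_fun\<close> converges absolutely).
\<close>

definition H_dom :: "nat \<Rightarrow> state set" where
  "H_dom K = {\<psi>.
      (\<forall>k\<in>{1..K}. (\<lambda>n. (cmod (\<psi> k n))\<^sup>2) summable_on UNIV) \<and>
      (\<forall>k\<in>{1..K}. (\<lambda>n. real n * (cmod (\<psi> k n))\<^sup>2) summable_on UNIV) \<and>
      (\<exists>k\<in>{1..K}. \<exists>n. \<psi> k n \<noteq> 0)}"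


section \<open>The nonlinear Schroedinger equation\<close>

text \<open>The Wirtinger derivative \<open>\<partial>f/\<partial>cnj z = (\<partial>f/\<partial>x + \<i> \<partial>f/\<partial>y) / 2\<close>, where \<open>z = x + \<i> y\<close>.\<close>

definition deriv_cnj :: "(complex \<Rightarrow> complex) \<Rightarrow> complex \<Rightarrow> complex" where
  "deriv_cnj f z = (frechet_derivative f (at z) 1 + \<i> * frechet_derivative f (at z) \<i>) / 2"

definition partial_cnj :: "(state \<Rightarrow> complex) \<Rightarrow> state \<Rightarrow> nat \<Rightarrow> nat \<Rightarrow> complex" where
  "partial_cnj F \<psi> k n = deriv_cnj (\<lambda>z. F (\<psi>(k := (\<psi> k)(n := z)))) (\<psi> k n)"

definition NLSE_solution ::
  "nat \<Rightarrow> real \<Rightarrow> (nat \<Rightarrow> real) \<Rightarrow> real \<Rightarrow> real \<Rightarrow> (nat \<Rightarrow> real) \<Rightarrow> real set \<Rightarrow> (real \<Rightarrow> state) \<Rightarrow> bool"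
where
  "NLSE_solution K hb \<omega> \<omega>f q \<epsilon> T \<psi> \<longleftrightarrow>
     (\<forall>t\<in>T. \<psi> t \<in> H_dom K \<and>
       (\<forall>k\<in>{1..K}. \<forall>n. \<exists>D.
          ((\<lambda>s. \<psi> s k n) has_vector_derivative D) (at t within T) \<and>
          \<i> * of_real hb * D = partial_cnj (H_fun K hb \<omega> \<omega>f q \<epsilon>) (\<psi> t) k n))"


section \<open>Jacobi elliptic functions of real argument and modulus \<open>0 \<le> \<kappa> < 1\<close>\<close>

text \<open>
  The interval integral is oriented, so \<open>elliptic_F \<kappa>\<close> is an odd increasing bijection of the reals
  for \<open>0 \<le> \<kappa> < 1\<close>, and the amplitude is its inverse.
\<close>

definition elliptic_F :: "real \<Rightarrow> real \<Rightarrow> real" where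
  "elliptic_F \<kappa> \<phi> = (LBINT \<theta>=ereal 0..ereal \<phi>. 1 / sqrt (1 - \<kappa>\<^sup>2 * (sin \<theta>)\<^sup>2))"

definition jacobi_am :: "real \<Rightarrow> real \<Rightarrow> real" where
  "jacobi_am u \<kappa> = (THE \<phi>. elliptic_F \<kappa> \<phi> = u)"

definition jacobi_cn :: "real \<Rightarrow> real \<Rightarrow> real" where
  "jacobi_cn u \<kappa> = cos (jacobi_am u \<kappa>)"

definition jacobi_dn :: "real \<Rightarrow> real \<Rightarrow> real" where
  "jacobi_dn u \<kappa> = sqrt (1 - \<kappa>\<^sup>2 * (sin (jacobi_am u \<kappa>))\<^sup>2)"

end

theory Submission
  imports Defs
begin

text \<open>
  The mean nonlinearity \<open>E\<close> enters the equations of motion only through real diagonal terms, so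
  whatever its time dependence, each block \<open>(\<psi> 1 (m + 1), \<psi> 2 m)\<close> of the Hamiltonian dynamics
  conserves its own norm. Hence all components except \<open>a = \<psi> 1 n\<close> and \<open>b = \<psi> 2 (n - 1)\<close> vanish for
  all times. Then \<open>E\<close> is affine in the inversion \<open>w\<close>, and the resonance condition makes the detuning
  of the remaining two-level system equal to \<open>2 * \<sigma> * w\<close>. The Bloch equations for \<open>P = cnj a * b\<close> have
  the first integral \<open>Im P + \<sigma> / (2 * \<Omega>) * w\<^sup>2\<close>, which closes the second order equation for \<open>w\<close>.
  The elliptic functions solve the same initial value problem, and Gronwall's argument gives uniqueness.
\<close>

section \<open>The gradient of the Hamiltonian function\<close>

text \<open>Basis vector \<open>|k>|n>\<close>. Replacing one component of a state amounts to adding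
  a multiple of it, so \<open>partial_cnj\<close> becomes an expansion of brackets along
  \<open>ket k n\<close>.\<close>

definition ket :: "nat \<Rightarrow> nat \<Rightarrow> state" where
  "ket k n = (\<lambda>j m. if j = k \<and> m = n then 1 else 0)"

text \<open>In (f'(1) + \<i> f'(\<i>)) / 2 the two \<beta> terms cancel because \<i> squared is -1,
  while the \<alpha> terms add up. The derivative is thus the coefficient of \<open>cnj h\<close> in
  the real-linear differential.\<close>

lemma deriv_cnj_eqI:
  assumes "(f has_derivative (\<lambda>h. \<alpha> * cnj h + \<beta> * h)) (at z)"
  shows "deriv_cnj f z = \<alpha>"
proof -
  have "frechet_derivative f (at z) = (\<lambda>h. \<alpha> * cnj h + \<beta> * h)"
    using frechet_derivative_at[OF assms] by simp
  then show ?thesis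
    by (simp add: deriv_cnj_def algebra_simps)
qed

text \<open>Sesquilinear expansion, with \<open>X\<close> and \<open>M\<close> standing for the
  images of \<psi> and \<open>ket k n\<close> under a linear operator. Among the four pairings only
  the one of \<psi> with \<open>X\<close> can be a genuinely infinite series; the others have finite
  support.\<close>

lemma braket_add_ket:
  assumes k: "k \<in> {1..K}"
    and summ: "\<And>j. j \<in> {1..K} \<Longrightarrow> (\<lambda>m. cnj (\<psi> j m) * X j m) summable_on UNIV"
    and fin: "\<And>j. finite {m. M j m \<noteq> 0}"
  shows "braket K (\<lambda>j m. \<psi> j m + d * ket k n j m) (\<lambda>j m. X j m + d * M j m) =
         braket K \<psi> X + cnj d * X k n + d * braket K \<psi> M + cnj d * d * M k n"
proof -
  have "(\<Sum>\<^sub>\<infinity>m. cnj (\<psi> j m + d * ket k n j m) * (X j m + d * M j m)) =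
        (\<Sum>\<^sub>\<infinity>m. cnj (\<psi> j m) * X j m) + d * (\<Sum>\<^sub>\<infinity>m. cnj (\<psi> j m) * M j m)
        + (if j = k then cnj d * (X k n + d * M k n) else 0)"
    if j: "j \<in> {1..K}" for j
  proof -
    have "finite {m \<in> UNIV. cnj (\<psi> j m) * M j m \<noteq> 0}"
      by (rule finite_subset[OF _ fin[of j]]) auto
    then have M: "(\<lambda>m. cnj (\<psi> j m) * M j m) summable_on UNIV"
      by (rule finite_nonzero_values_imp_summable_on)
    have K: "((\<lambda>m. cnj (d * ket k n j m) * (X j m + d * M j m)) has_sum
              (if j = k then cnj d * (X k n + d * M k n) else 0)) UNIV"
      by (rule has_sum_finite_neutralI[of "{n}"]) (auto simp: ket_def)
    have "((\<lambda>m. cnj (\<psi> j m) * X j m + d * (cnj (\<psi> j m) * M j m)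
            + cnj (d * ket k n j m) * (X j m + d * M j m)) has_sum
          (\<Sum>\<^sub>\<infinity>m. cnj (\<psi> j m) * X j m) + d * (\<Sum>\<^sub>\<infinity>m. cnj (\<psi> j m) * M j m)
        + (if j = k then cnj d * (X k n + d * M k n) else 0)) UNIV"
      by (intro has_sum_add has_sum_cmult_right has_sum_infsum summ[OF j] M K)
    from infsumI[OF this] show ?thesis
      by (simp add: algebra_simps)
  qed
  then show ?thesis
    using k by (simp add: braket_def sum.distrib sum_distrib_left algebra_simps)
qed

section \<open>Component formulas, linearity and finite supports of the operators\<close>

lemma eps_op_eq:
  "j \<in> {1..K} \<Longrightarrow> eps_op K \<epsilon> \<psi> j m = of_real (\<epsilon> j) * \<psi> j m"
  by (simp add: eps_op_def bb_def if_distrib cong: if_cong)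

lemma creat_annih: "creat (annih \<psi>) j m = of_nat m * \<psi> j m"
  by (cases m) (simp_all add: creat_def annih_def flip: of_real_mult mult.assoc)

text \<open>The truncated subtraction \<open>m - 1\<close> is harmless: at \<open>m = 0\<close> its
  term carries the factor \<open>sqrt 0\<close>.\<close>

lemma H_lin_eq:
  assumes "j \<in> {1..K}"
  shows "H_lin K hb \<omega> \<omega>f q \<psi> j m =
    of_real (hb * \<omega> j + real m * (hb * \<omega>f)) * \<psi> j m
    + \<i> * of_real (hb * q) / 2 *
      ((if j = 2 then of_real (sqrt (real (Suc m))) * \<psi> 1 (Suc m) else 0)
       - (if j = 1 then of_real (sqrt (real m)) * \<psi> 2 (m - 1) else 0))"
proof -
  have "(\<Sum>k\<in>{1..K}. of_real (hb * \<omega> k) * bb k k \<psi> j m) = of_real (hb * \<omega> j) * \<psi> j m"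
    using assms by (simp add: bb_def if_distrib cong: if_cong)
  moreover have "bb 2 1 (annih \<psi>) j m =
      (if j = 2 then of_real (sqrt (real (Suc m))) * \<psi> 1 (Suc m) else 0)"
    by (simp add: bb_def annih_def)
  moreover have "creat (bb 1 2 \<psi>) j m = (if j = 1 then of_real (sqrt (real m)) * \<psi> 2 (m - 1) else 0)"
    by (simp add: bb_def creat_def)
  ultimately show ?thesis
    by (simp only: H_lin_def creat_annih) (simp add: algebra_simps)
qed

lemma bb_add: "bb k l (\<lambda>j m. \<psi> j m + d * \<phi> j m) j m = bb k l \<psi> j m + d * bb k l \<phi> j m"
  by (simp add: bb_def)

lemma annih_add: "annih (\<lambda>j m. \<psi> j m + d * \<phi> j m) j m = annih \<psi> j m + d * annih \<phi> j m"
  by (simp add: annih_def algebra_simps)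

lemma creat_add: "creat (\<lambda>j m. \<psi> j m + d * \<phi> j m) j m = creat \<psi> j m + d * creat \<phi> j m"
  by (simp add: creat_def algebra_simps)

lemma H_lin_add:
  "H_lin K hb \<omega> \<omega>f q (\<lambda>j m. \<psi> j m + d * \<phi> j m) j m =
   H_lin K hb \<omega> \<omega>f q \<psi> j m + d * H_lin K hb \<omega> \<omega>f q \<phi> j m"
  unfolding H_lin_def bb_add[abs_def] annih_add[abs_def] creat_add[abs_def]
  by (simp only: distrib_left sum.distrib sum_distrib_left) (simp add: algebra_simps)

lemma eps_op_add:
  "eps_op K \<epsilon> (\<lambda>j m. \<psi> j m + d * \<phi> j m) j m = eps_op K \<epsilon> \<psi> j m + d * eps_op K \<epsilon> \<phi> j m"
  unfolding eps_op_def bb_add[abs_def]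
  by (simp only: distrib_left sum.distrib sum_distrib_left) (simp add: algebra_simps)

lemma finite_ket_support: "finite {m. ket k n j m \<noteq> 0}"
  by (rule finite_subset[of _ "{n}"]) (auto simp: ket_def)

lemma finite_eps_op_ket_support: "finite {m. eps_op K \<epsilon> (ket k n) j m \<noteq> 0}"
proof (rule finite_subset[of _ "{n}"])
  have "eps_op K \<epsilon> (ket k n) j m = 0" if "m \<noteq> n" for m
    using that by (simp add: eps_op_def bb_def ket_def cong: if_cong)
  then show "{m. eps_op K \<epsilon> (ket k n) j m \<noteq> 0} \<subseteq> {n}" by auto
qed simp

lemma finite_H_lin_ket_support: "finite {m. H_lin K hb \<omega> \<omega>f q (ket k n) j m \<noteq> 0}"
proof (rule finite_subset[of _ "{..Suc n}"])
  have "H_lin K hb \<omega> \<omega>f q (ket k n) j m = 0" if "m > Suc n" for m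
    using that by (auto simp: H_lin_def bb_def creat_def annih_def ket_def cong: if_cong)
  then show "{m. H_lin K hb \<omega> \<omega>f q (ket k n) j m \<noteq> 0} \<subseteq> {..Suc n}"
    by (auto simp: not_less[symmetric])
qed simp

section \<open>Convergence of the brackets on \<open>H_dom\<close>\<close>

lemma summable_H_dom_norm:
  assumes "\<psi> \<in> H_dom K" "j \<in> {1..K}"
  shows "(\<lambda>m. cnj (\<psi> j m) * \<psi> j m) summable_on UNIV"
proof -
  have "(\<lambda>m. norm (cnj (\<psi> j m) * \<psi> j m)) summable_on UNIV"
    using assms by (simp add: H_dom_def norm_mult power2_eq_square)
  then show ?thesis by (rule abs_summable_summable)
qed

lemma summable_H_dom_photon:
  assumes "\<psi> \<in> H_dom K" "j \<in> {1..K}"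
  shows "(\<lambda>m. of_nat m * (cnj (\<psi> j m) * \<psi> j m)) summable_on UNIV"
proof -
  have "(\<lambda>m. norm (of_nat m * (cnj (\<psi> j m) * \<psi> j m))) summable_on UNIV"
    using assms by (simp add: H_dom_def norm_mult power2_eq_square)
  then show ?thesis by (rule abs_summable_summable)
qed

lemma sum_squares_ge_prod: "x * y \<le> x\<^sup>2 + y\<^sup>2" for x y :: real
proof -
  have "0 \<le> (x - y)\<^sup>2 + x\<^sup>2 + y\<^sup>2" by simp
  then show ?thesis by (simp add: power2_diff)
qed

text \<open>By x y \<le> x^2 + y^2, where the square root of the photon number is always attached to
  the factor with more photons. The finite mean photon number in \<open>H_dom\<close> then dominates
  that square.\<close>

lemma summable_H_dom_coupling:
  assumes \<psi>: "\<psi> \<in> H_dom K" and j: "i \<in> {1..K}" "j \<in> {1..K}"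
  shows "(\<lambda>m. cnj (\<psi> i m) * (of_real (sqrt (real (Suc m))) * \<psi> j (Suc m))) summable_on UNIV" (is ?A)
    and "(\<lambda>m. cnj (\<psi> i m) * (of_real (sqrt (real m)) * \<psi> j (m - 1))) summable_on UNIV" (is ?B)
proof -
  have Suc: "(\<lambda>m. real (Suc m) * (cmod (\<psi> j (Suc m)))\<^sup>2) summable_on UNIV"
  proof -
    have "(\<lambda>m. real m * (cmod (\<psi> j m))\<^sup>2) summable_on UNIV"
      using \<psi> j by (simp add: H_dom_def)
    then have "(\<lambda>m. real m * (cmod (\<psi> j m))\<^sup>2) summable_on range Suc"
      by (rule summable_on_subset_banach) simp
    then show ?thesis
      by (subst (asm) summable_on_reindex) (auto simp: o_def)
  qed
  have "(\<lambda>m. norm (cnj (\<psi> i m) * (of_real (sqrt (real (Suc m))) * \<psi> j (Suc m)))) summable_on UNIV"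
  proof (rule summable_on_comparison_test)
    show "(\<lambda>m. (cmod (\<psi> i m))\<^sup>2 + real (Suc m) * (cmod (\<psi> j (Suc m)))\<^sup>2) summable_on UNIV"
      using \<psi> j Suc by (intro summable_on_add) (simp_all add: H_dom_def)
    show "norm (cnj (\<psi> i m) * (of_real (sqrt (real (Suc m))) * \<psi> j (Suc m)))
      \<le> (cmod (\<psi> i m))\<^sup>2 + real (Suc m) * (cmod (\<psi> j (Suc m)))\<^sup>2" for m
      using sum_squares_ge_prod[of "cmod (\<psi> i m)" "sqrt (real (Suc m)) * cmod (\<psi> j (Suc m))"]
      by (simp add: norm_mult power_mult_distrib)
  qed simp
  then show ?A by (rule abs_summable_summable)
  \<comment> \<open>The value 0 at \<open>m = 0\<close> keeps the shifted sequence from counting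
    index 0 twice; what remains is a reindexing along \<open>Suc\<close>.\<close>
  have pred: "(\<lambda>m. if m = 0 then 0 else (cmod (\<psi> j (m - 1)))\<^sup>2) summable_on UNIV"
  proof -
    have "(\<lambda>m. if m = 0 then 0 else (cmod (\<psi> j (m - 1)))\<^sup>2) summable_on range Suc"
      using \<psi> j by (subst summable_on_reindex) (auto simp: o_def H_dom_def)
    moreover have "(\<lambda>m. if m = 0 then 0 else (cmod (\<psi> j (m - 1)))\<^sup>2) summable_on range Suc \<longleftrightarrow>
        (\<lambda>m. if m = 0 then 0 else (cmod (\<psi> j (m - 1)))\<^sup>2) summable_on UNIV"
    proof (rule summable_on_cong_neutral)
      fix m :: nat assume "m \<in> UNIV - range Suc"
      then have "m = 0" by (cases m) auto
      then show "(if m = 0 then 0 else (cmod (\<psi> j (m - 1)))\<^sup>2) = 0" by simp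
    qed auto
    ultimately show ?thesis by simp
  qed
  have "(\<lambda>m. norm (cnj (\<psi> i m) * (of_real (sqrt (real m)) * \<psi> j (m - 1)))) summable_on UNIV"
  proof (rule summable_on_comparison_test)
    show "(\<lambda>m. real m * (cmod (\<psi> i m))\<^sup>2 + (if m = 0 then 0 else (cmod (\<psi> j (m - 1)))\<^sup>2)) summable_on UNIV"
      using \<psi> j pred by (intro summable_on_add) (simp_all add: H_dom_def)
    show "norm (cnj (\<psi> i m) * (of_real (sqrt (real m)) * \<psi> j (m - 1)))
      \<le> real m * (cmod (\<psi> i m))\<^sup>2 + (if m = 0 then 0 else (cmod (\<psi> j (m - 1)))\<^sup>2)" for m
      using sum_squares_ge_prod[of "sqrt (real m) * cmod (\<psi> i m)" "cmod (\<psi> j (m - 1))"]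
      by (simp add: norm_mult power_mult_distrib mult_ac)
  qed simp
  then show ?B by (rule abs_summable_summable)
qed

lemma summable_H_dom_H_lin:
  assumes \<psi>: "\<psi> \<in> H_dom K" and j: "j \<in> {1..K}" and K: "K \<ge> 2"
  shows "(\<lambda>m. cnj (\<psi> j m) * H_lin K hb \<omega> \<omega>f q \<psi> j m) summable_on UNIV"
proof -
  define c where "c = \<i> * of_real (hb * q) / 2"
  have 1: "(\<lambda>m. if j = 2 then cnj (\<psi> j m) * (of_real (sqrt (real (Suc m))) * \<psi> 1 (Suc m)) else 0)
      summable_on UNIV"
    using summable_H_dom_coupling(1)[OF \<psi> j, of 1] K by (cases "j = 2") simp_all
  have 2: "(\<lambda>m. if j = 1 then cnj (\<psi> j m) * (of_real (sqrt (real m)) * \<psi> 2 (m - 1)) else 0)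
      summable_on UNIV"
    using summable_H_dom_coupling(2)[OF \<psi> j, of 2] K by (cases "j = 1") simp_all
  have "(\<lambda>m. of_real (hb * \<omega> j) * (cnj (\<psi> j m) * \<psi> j m)
      + of_real (hb * \<omega>f) * (of_nat m * (cnj (\<psi> j m) * \<psi> j m))
      + c * (if j = 2 then cnj (\<psi> j m) * (of_real (sqrt (real (Suc m))) * \<psi> 1 (Suc m)) else 0)
      + (- c) * (if j = 1 then cnj (\<psi> j m) * (of_real (sqrt (real m)) * \<psi> 2 (m - 1)) else 0))
      summable_on UNIV"
    by (intro summable_on_add summable_on_cmult_right 1 2
        summable_H_dom_norm[OF \<psi> j] summable_H_dom_photon[OF \<psi> j])
  then show ?thesis
    by (rule summable_on_cong[THEN iffD1, rotated])
      (subst H_lin_eq[OF j], simp add: c_def algebra_simps)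
qed

text \<open>\<open>H_fun\<close> divides by this bracket. It is a sum of squared moduli, bounded
  below by the square of any nonvanishing component.\<close>

lemma braket_self_nonzero:
  assumes "\<psi> \<in> H_dom K"
  shows "braket K \<psi> \<psi> \<noteq> 0"
proof -
  obtain k n where k: "k \<in> {1..K}" "\<psi> k n \<noteq> 0"
    using assms by (auto simp: H_dom_def)
  have summ: "(\<lambda>m. (cmod (\<psi> j m))\<^sup>2) summable_on UNIV" if "j \<in> {1..K}" for j
    using assms that by (simp add: H_dom_def)
  have "0 < (\<Sum>\<^sub>\<infinity>m\<in>{n}. (cmod (\<psi> k m))\<^sup>2)"
    using k by simp
  also have "\<dots> \<le> (\<Sum>\<^sub>\<infinity>m. (cmod (\<psi> k m))\<^sup>2)"
    using summ[OF k(1)] by (intro infsum_mono_neutral) auto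
  also have "\<dots> \<le> (\<Sum>j\<in>{1..K}. \<Sum>\<^sub>\<infinity>m. (cmod (\<psi> j m))\<^sup>2)"
    using k(1) by (intro member_le_sum infsum_nonneg) auto
  finally have "0 < (\<Sum>j\<in>{1..K}. \<Sum>\<^sub>\<infinity>m. (cmod (\<psi> j m))\<^sup>2)" .
  moreover have "braket K \<psi> \<psi> = of_real (\<Sum>j\<in>{1..K}. \<Sum>\<^sub>\<infinity>m. (cmod (\<psi> j m))\<^sup>2)"
    unfolding braket_def of_real_sum
  proof (rule sum.cong)
    fix j assume "j \<in> {1..K}"
    from has_sum_of_real[OF has_sum_infsum[OF summ[OF this]], where 'a = complex]
    show "(\<Sum>\<^sub>\<infinity>m. cnj (\<psi> j m) * \<psi> j m) = of_real (\<Sum>\<^sub>\<infinity>m. (cmod (\<psi> j m))\<^sup>2)"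
      by (intro infsumI) (simp add: complex_norm_square mult.commute del: of_real_power flip: of_real_power)
  qed simp
  ultimately show ?thesis by (metis less_irrefl of_real_eq_0_iff)
qed

section \<open>The mean nonlinearity and the equations of motion\<close>

definition mean_eps :: "nat \<Rightarrow> (nat \<Rightarrow> real) \<Rightarrow> state \<Rightarrow> real" where
  "mean_eps K \<epsilon> \<psi> = Re (braket K \<psi> (eps_op K \<epsilon> \<psi>) / braket K \<psi> \<psi>)"

text \<open>Both brackets equal their conjugates, since the operator is diagonal with real entries.
  The \<open>Re\<close> in the definition of \<open>mean_eps\<close> therefore discards
  nothing.\<close>

lemma mean_eps_eq:
  "braket K \<psi> (eps_op K \<epsilon> \<psi>) / braket K \<psi> \<psi> = of_real (mean_eps K \<epsilon> \<psi>)"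
proof -
  have "cnj (braket K \<psi> \<psi>) = braket K \<psi> \<psi>"
    unfolding braket_def by (simp add: cnj_sum mult.commute flip: infsum_cnj)
  moreover have "cnj (braket K \<psi> (eps_op K \<epsilon> \<psi>)) = braket K \<psi> (eps_op K \<epsilon> \<psi>)"
    unfolding braket_def cnj_sum infsum_cnj[symmetric]
    by (rule sum.cong[OF refl], rule infsum_cong) (simp add: eps_op_eq mult_ac)
  ultimately have "cnj (braket K \<psi> (eps_op K \<epsilon> \<psi>) / braket K \<psi> \<psi>)
      = braket K \<psi> (eps_op K \<epsilon> \<psi>) / braket K \<psi> \<psi>"
    by simp
  then show ?thesis
    by (metis Reals_cnj_iff complex_is_Real_iff mean_eps_def of_real_Re)
qed

text \<open>As a function of the single component \<open>x\<close>, \<open>H_fun\<close> is a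
  quadratic plus a squared quadratic over a quadratic, in \<open>x - z\<close> and its conjugate.
  The quotient rule at \<open>x = z\<close> produces 2 (N/Q) e z - (N/Q)^2 z, and
  \<open>N / Q\<close> is the mean \<open>E\<close>.\<close>

lemma partial_cnj_H_fun:
  assumes \<psi>: "\<psi> \<in> H_dom K" and k: "k \<in> {1..K}" and K: "K \<ge> 2"
    and E_def: "E = mean_eps K \<epsilon> \<psi>"
  shows "partial_cnj (H_fun K hb \<omega> \<omega>f q \<epsilon>) \<psi> k n =
    H_lin K hb \<omega> \<omega>f q \<psi> k n + of_real (2 * E * \<epsilon> k - E\<^sup>2) * \<psi> k n"
proof -
  define z where "z = \<psi> k n"
  define Q where "Q = braket K \<psi> \<psi>"
  define N where "N = braket K \<psi> (eps_op K \<epsilon> \<psi>)"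
  define e where "e = (of_real (\<epsilon> k) :: complex)"
  define A where "A = braket K \<psi> (H_lin K hb \<omega> \<omega>f q \<psi>)"
  define \<alpha> where "\<alpha> = H_lin K hb \<omega> \<omega>f q \<psi> k n"
  define \<beta> where "\<beta> = braket K \<psi> (H_lin K hb \<omega> \<omega>f q (ket k n))"
  define \<gamma> where "\<gamma> = H_lin K hb \<omega> \<omega>f q (ket k n) k n"
  have Q: "Q \<noteq> 0"
    using braket_self_nonzero[OF \<psi>] by (simp add: Q_def)
  have NQ: "N / Q = of_real E"
    by (simp add: N_def Q_def E_def mean_eps_eq)
  have upd: "\<psi>(k := (\<psi> k)(n := x)) = (\<lambda>j m. \<psi> j m + (x - z) * ket k n j m)" for x
    by (intro ext) (auto simp: ket_def z_def)
  have ket_left: "braket K \<psi> (\<lambda>j m. c j * ket k n j m) = c k * cnj z" for c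
  proof -
    have "(\<Sum>\<^sub>\<infinity>m. cnj (\<psi> j m) * (c j * ket k n j m)) = (if j = k then c k * cnj z else 0)" for j
      by (rule infsumI, rule has_sum_finite_neutralI[of "{n}"]) (auto simp: ket_def z_def)
    then show ?thesis
      using k by (simp add: braket_def)
  qed
  have eps_ket: "braket K \<psi> (eps_op K \<epsilon> (ket k n)) = e * cnj z"
    unfolding ket_left[of "\<lambda>j. of_real (\<epsilon> j)", folded e_def, symmetric] braket_def
    by (intro sum.cong infsum_cong refl) (simp add: eps_op_eq)
  have "H_fun K hb \<omega> \<omega>f q \<epsilon> (\<psi>(k := (\<psi> k)(n := x))) =
      (A + cnj (x - z) * \<alpha> + (x - z) * \<beta> + cnj (x - z) * (x - z) * \<gamma>)
      + (N + cnj (x - z) * (e * z) + (x - z) * (e * cnj z) + cnj (x - z) * (x - z) * e)\<^sup>2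
        / (Q + cnj (x - z) * z + (x - z) * cnj z + cnj (x - z) * (x - z))" for x
  proof -
    have H: "braket K (\<lambda>j m. \<psi> j m + (x - z) * ket k n j m)
        (H_lin K hb \<omega> \<omega>f q (\<lambda>j m. \<psi> j m + (x - z) * ket k n j m)) =
        A + cnj (x - z) * \<alpha> + (x - z) * \<beta> + cnj (x - z) * (x - z) * \<gamma>"
      unfolding H_lin_add[abs_def] A_def \<alpha>_def \<beta>_def \<gamma>_def
      by (rule braket_add_ket[OF k summable_H_dom_H_lin[OF \<psi> _ K] finite_H_lin_ket_support])
    have "(\<lambda>m. cnj (\<psi> j m) * eps_op K \<epsilon> \<psi> j m) summable_on UNIV" if "j \<in> {1..K}" for j
      using summable_on_cmult_right[OF summable_H_dom_norm[OF \<psi> that], of "of_real (\<epsilon> j)"]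
      by (simp add: eps_op_eq[OF that] mult_ac)
    then have E: "braket K (\<lambda>j m. \<psi> j m + (x - z) * ket k n j m)
        (eps_op K \<epsilon> (\<lambda>j m. \<psi> j m + (x - z) * ket k n j m)) =
        N + cnj (x - z) * (e * z) + (x - z) * (e * cnj z) + cnj (x - z) * (x - z) * e"
      unfolding eps_op_add[abs_def] N_def
      by (subst braket_add_ket[OF k _ finite_eps_op_ket_support])
        (auto simp: eps_ket eps_op_eq[OF k] e_def z_def, simp add: ket_def)
    have "braket K (\<lambda>j m. \<psi> j m + (x - z) * ket k n j m) (\<lambda>j m. \<psi> j m + (x - z) * ket k n j m) =
        Q + cnj (x - z) * z + (x - z) * cnj z + cnj (x - z) * (x - z)"
      unfolding Q_def
      by (subst braket_add_ket[OF k summable_H_dom_norm[OF \<psi>] finite_ket_support])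
        (use ket_left[of "\<lambda>_. 1"] in \<open>auto simp: z_def ket_def\<close>)
    with H E show ?thesis
      by (simp add: H_fun_def upd)
  qed
  \<comment> \<open>At \<open>x = z\<close> the mixed terms \<open>cnj (x - z) * (x - z)\<close>
    have zero differential, so \<gamma> and the quadratic part of the norm leave no trace.\<close>
  moreover have "((\<lambda>x. (A + cnj (x - z) * \<alpha> + (x - z) * \<beta> + cnj (x - z) * (x - z) * \<gamma>)
      + (N + cnj (x - z) * (e * z) + (x - z) * (e * cnj z) + cnj (x - z) * (x - z) * e)\<^sup>2
        / (Q + cnj (x - z) * z + (x - z) * cnj z + cnj (x - z) * (x - z)))
      has_derivative (\<lambda>h. (\<alpha> + 2 * (N / Q) * e * z - (N / Q)\<^sup>2 * z) * cnj h
        + (\<beta> + 2 * (N / Q) * e * cnj z - (N / Q)\<^sup>2 * cnj z) * h)) (at z)"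
    by (rule derivative_eq_intros refl bounded_linear_imp_has_derivative bounded_linear_cnj
        | use Q in \<open>simp; fail\<close>)+
      (use Q in \<open>auto simp: fun_eq_iff field_simps power2_eq_square\<close>)
  ultimately have "partial_cnj (H_fun K hb \<omega> \<omega>f q \<epsilon>) \<psi> k n
      = \<alpha> + 2 * (N / Q) * e * z - (N / Q)\<^sup>2 * z"
    unfolding partial_cnj_def by (simp add: deriv_cnj_eqI z_def)
  then show ?thesis
    by (simp add: NQ \<alpha>_def z_def e_def algebra_simps)
qed

text \<open>Dividing by \<i> \<open>hb\<close> turns the diagonal part into a rotation with real
  frequency \<nu> and the coupling into the real constant \<open>q / 2\<close> with opposite signs
  on the two levels. This is the shape that the two-level lemmas require.\<close>

lemma NLSE_component_deriv:
  assumes sol: "NLSE_solution K hb \<omega> \<omega>f q \<epsilon> T \<psi>" and t: "t \<in> T" and k: "k \<in> {1..K}"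
    and K: "K \<ge> 2" and hb: "hb > 0"
    and \<nu>_def: "\<nu> = \<omega> k + real m * \<omega>f +
    (2 * mean_eps K \<epsilon> (\<psi> t) * \<epsilon> k - (mean_eps K \<epsilon> (\<psi> t))\<^sup>2) / hb"
  shows "((\<lambda>s. \<psi> s k m) has_vector_derivative - \<i> * of_real \<nu> * \<psi> t k m
    + of_real (q / 2) * ((if k = 2 then of_real (sqrt (real (Suc m))) * \<psi> t 1 (Suc m) else 0)
       - (if k = 1 then of_real (sqrt (real m)) * \<psi> t 2 (m - 1) else 0))) (at t within T)"
    (is "(_ has_vector_derivative ?R) _")
proof -
  define E where "E = mean_eps K \<epsilon> (\<psi> t)"
  define c where "c = (if k = 2 then of_real (sqrt (real (Suc m))) * \<psi> t 1 (Suc m) else 0)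
       - (if k = 1 then of_real (sqrt (real m)) * \<psi> t 2 (m - 1) else 0)"
  from sol t k obtain D where D: "((\<lambda>s. \<psi> s k m) has_vector_derivative D) (at t within T)"
    and iD: "\<i> * of_real hb * D = partial_cnj (H_fun K hb \<omega> \<omega>f q \<epsilon>) (\<psi> t) k m"
    and dom: "\<psi> t \<in> H_dom K"
    unfolding NLSE_solution_def by blast
  have "\<i> * of_real hb * D = of_real (hb * \<omega> k + real m * (hb * \<omega>f)) * \<psi> t k m
      + \<i> * of_real (hb * q) / 2 * c + of_real (2 * E * \<epsilon> k - E\<^sup>2) * \<psi> t k m"
    unfolding iD partial_cnj_H_fun[OF dom k K E_def] H_lin_eq[OF k] c_def ..
  also have "hb * \<omega> k + real m * (hb * \<omega>f) = hb * \<nu> - (2 * E * \<epsilon> k - E\<^sup>2)"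
    using hb by (simp add: \<nu>_def E_def field_simps)
  finally have "\<i> * of_real hb * D = \<i> * of_real hb * (- \<i> * of_real \<nu> * \<psi> t k m + of_real (q / 2) * c)"
    by (simp add: algebra_simps)
  then have "D = - \<i> * of_real \<nu> * \<psi> t k m + of_real (q / 2) * c"
    using hb by (simp only: mult_cancel_left) simp
  then show ?thesis
    using D by (simp add: c_def)
qed

section \<open>Two-level dynamics\<close>

lemma has_vector_derivative_cnj_mult:
  assumes "(f has_vector_derivative f') (at t within T)" "(g has_vector_derivative g') (at t within T)"
  shows "((\<lambda>s. cnj (f s) * g s) has_vector_derivative cnj (f t) * g' + cnj f' * g t) (at t within T)"
  by (intro has_vector_derivative_mult assms
      bounded_linear.has_vector_derivative[OF bounded_linear_cnj assms(1)])

lemma has_real_derivative_Re: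
  "(f has_vector_derivative f') (at t within T) \<Longrightarrow> ((\<lambda>s. Re (f s)) has_real_derivative Re f') (at t within T)"
  unfolding has_real_derivative_iff_has_vector_derivative
  by (rule bounded_linear.has_vector_derivative[OF bounded_linear_Re])

lemma has_real_derivative_Im:
  "(f has_vector_derivative f') (at t within T) \<Longrightarrow> ((\<lambda>s. Im (f s)) has_real_derivative Im f') (at t within T)"
  unfolding has_real_derivative_iff_has_vector_derivative
  by (rule bounded_linear.has_vector_derivative[OF bounded_linear_Im])

lemma has_real_derivative_cmod_sq:
  assumes "(f has_vector_derivative f') (at t within T)"
  shows "((\<lambda>s. (cmod (f s))\<^sup>2) has_real_derivative 2 * Re (cnj (f t) * f')) (at t within T)"
proof -
  have "(\<lambda>s. (cmod (f s))\<^sup>2) = (\<lambda>s. Re (cnj (f s) * f s))"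
    by (rule ext, subst cmod_power2) (simp add: power2_eq_square)
  then show ?thesis
    using has_real_derivative_Re[OF has_vector_derivative_cnj_mult[OF assms assms]]
    by simp (simp add: algebra_simps)
qed

lemma real_deriv_zero_eq:
  fixes f :: "real \<Rightarrow> real"
  assumes "is_interval T" "s \<in> T" "t \<in> T"
    and "\<And>x. x \<in> T \<Longrightarrow> (f has_real_derivative 0) (at x within T)"
  shows "f t = f s"
  using has_field_derivative_zero_constant[OF is_interval_convex[OF assms(1)] assms(4)] assms(2,3)
  by auto

text \<open>Real frequencies rotate phases without changing moduli, and the coupling terms
  \<open>- c\<close> and \<open>c\<close> exchange norm between the amplitudes. \<open>A\<close> and
  \<open>B\<close> are arbitrary real functions of time, so they may depend on the solution
  itself.\<close>

lemma two_level_norm: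
  fixes a b :: "real \<Rightarrow> complex" and A B :: "real \<Rightarrow> real" and c :: real
  assumes T: "is_interval T" "0 \<in> T" and t: "t \<in> T"
    and a: "\<And>t. t \<in> T \<Longrightarrow> (a has_vector_derivative - \<i> * A t * a t - c * b t) (at t within T)"
    and b: "\<And>t. t \<in> T \<Longrightarrow> (b has_vector_derivative - \<i> * B t * b t + c * a t) (at t within T)"
  shows "(cmod (a t))\<^sup>2 + (cmod (b t))\<^sup>2 = (cmod (a 0))\<^sup>2 + (cmod (b 0))\<^sup>2"
proof (rule real_deriv_zero_eq[OF T t])
  fix x assume x: "x \<in> T"
  have "2 * Re (cnj (a x) * (- \<i> * A x * a x - c * b x))
      + 2 * Re (cnj (b x) * (- \<i> * B x * b x + c * a x)) = 0"
    by (simp add: algebra_simps)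
  then show "((\<lambda>t. (cmod (a t))\<^sup>2 + (cmod (b t))\<^sup>2) has_real_derivative 0) (at x within T)"
    using DERIV_add[OF has_real_derivative_cmod_sq[OF a[OF x]] has_real_derivative_cmod_sq[OF b[OF x]]]
    by simp
qed

text \<open>With P = \<open>cnj a * b\<close> one has w' = 2 \<Omega> Re P and P' = -2 \<i> \<sigma>
  w P - (\<Omega>/2) w. Hence w'' involves Im P only through w Im P, and a first integral expresses
  Im P by w.\<close>

lemma two_level_inversion_ode:
  fixes a b :: "real \<Rightarrow> complex" and A B :: "real \<Rightarrow> real" and \<Omega> \<sigma> :: real
  assumes T: "is_interval T" "0 \<in> T" and \<Omega>: "\<Omega> \<noteq> 0"
    and a: "\<And>t. t \<in> T \<Longrightarrow> (a has_vector_derivative - \<i> * A t * a t - (\<Omega> / 2) * b t) (at t within T)"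
    and b: "\<And>t. t \<in> T \<Longrightarrow> (b has_vector_derivative - \<i> * B t * b t + (\<Omega> / 2) * a t) (at t within T)"
    and init: "cmod (a 0) = 1" "b 0 = 0"
    and detuning: "\<And>t. t \<in> T \<Longrightarrow> B t - A t = 2 * \<sigma> * w t"
    and w: "\<And>t. t \<in> T \<Longrightarrow> w t = (cmod (b t))\<^sup>2 - (cmod (a t))\<^sup>2"
    and t: "t \<in> T"
  defines "w' \<equiv> \<lambda>t. 2 * \<Omega> * Re (cnj (a t) * b t)"
  shows "(w has_real_derivative w' t) (at t within T)"
    and "(w' has_real_derivative (2 * \<sigma>\<^sup>2 - \<Omega>\<^sup>2) * w t - 2 * \<sigma>\<^sup>2 * (w t) ^ 3) (at t within T)"
proof -
  define P where "P = (\<lambda>t. cnj (a t) * b t)"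
  have dw: "(w has_real_derivative w' s) (at s within T)" if s: "s \<in> T" for s
  proof -
    have "((\<lambda>t. (cmod (b t))\<^sup>2 - (cmod (a t))\<^sup>2) has_real_derivative w' s) (at s within T)"
      by (rule DERIV_cong[OF DERIV_diff[OF has_real_derivative_cmod_sq[OF b[OF s]]
              has_real_derivative_cmod_sq[OF a[OF s]]]])
        (simp add: w'_def algebra_simps)
    \<comment> \<open>The formula for \<open>w\<close> holds on \<open>T\<close> only, so the
      derivative is transferred within \<open>T\<close>.\<close>
    then show ?thesis
      unfolding has_field_derivative_def by (rule has_derivative_transform[OF s, rotated]) (rule w)
  qed
  then show "(w has_real_derivative w' t) (at t within T)" using t .
  have dP: "(P has_vector_derivative - \<i> * (2 * \<sigma> * w s) * P s - (\<Omega> / 2) * w s) (at s within T)"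
    if s: "s \<in> T" for s
  proof -
    have "cnj (a s) * (- \<i> * B s * b s + (\<Omega> / 2) * a s) + cnj (- \<i> * A s * a s - (\<Omega> / 2) * b s) * b s
        = - \<i> * (B s - A s) * P s - (\<Omega> / 2) * (b s * cnj (b s) - a s * cnj (a s))"
      by (simp add: P_def algebra_simps)
    also have "\<dots> = - \<i> * (2 * \<sigma> * w s) * P s - (\<Omega> / 2) * w s"
    proof -
      have "complex_of_real (w s) = b s * cnj (b s) - a s * cnj (a s)"
        unfolding w[OF s] of_real_diff complex_norm_square ..
      moreover have "complex_of_real (B s) - complex_of_real (A s) = 2 * \<sigma> * w s"
        using arg_cong[OF detuning[OF s], of complex_of_real] by simp
      ultimately show ?thesis by simp
    qed
    finally show ?thesis
      using has_vector_derivative_cnj_mult[OF a[OF s] b[OF s]] by (simp add: P_def)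
  qed
  \<comment> \<open>(Im P)' = -2 \<sigma> w Re P = -(\<sigma>/\<Omega>) w w', which is the
    derivative of -(\<sigma>/(2 \<Omega>)) w^2.\<close>
  have "Im (P t) + \<sigma> / (2 * \<Omega>) * (w t)\<^sup>2 = Im (P 0) + \<sigma> / (2 * \<Omega>) * (w 0)\<^sup>2"
  proof (rule real_deriv_zero_eq[OF T t])
    fix x assume x: "x \<in> T"
    show "((\<lambda>t. Im (P t) + \<sigma> / (2 * \<Omega>) * (w t)\<^sup>2) has_real_derivative 0) (at x within T)"
      by (rule derivative_eq_intros has_real_derivative_Im[OF dP[OF x]] dw[OF x] refl)+
        (use \<Omega> in \<open>simp add: w'_def P_def field_simps\<close>)
  qed
  \<comment> \<open>Initially P = 0 and w = -1, which fixes the constant of integration as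
    \<sigma>/(2 \<Omega>).\<close>
  then have ImP: "Im (P t) = \<sigma> / (2 * \<Omega>) * (1 - (w t)\<^sup>2)"
    using init w[OF T(2)] by (simp add: P_def algebra_simps)
  have "(w' has_real_derivative 2 * \<Omega> * Re (- \<i> * (2 * \<sigma> * w t) * P t - (\<Omega> / 2) * w t)) (at t within T)"
    unfolding w'_def P_def[symmetric]
    using DERIV_cmult[OF has_real_derivative_Re[OF dP[OF t]], of "2 * \<Omega>"] by (simp add: P_def)
  also have "2 * \<Omega> * Re (- \<i> * (2 * \<sigma> * w t) * P t - (\<Omega> / 2) * w t)
      = 2 * \<Omega> * (2 * \<sigma> * w t * Im (P t) - \<Omega> / 2 * w t)"
    by simp
  also have "\<dots> = (2 * \<sigma>\<^sup>2 - \<Omega>\<^sup>2) * w t - 2 * \<sigma>\<^sup>2 * (w t) ^ 3"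
    unfolding ImP using \<Omega> by (simp add: field_simps power2_eq_square power3_eq_cube)
  finally show "(w' has_real_derivative (2 * \<sigma>\<^sup>2 - \<Omega>\<^sup>2) * w t - 2 * \<sigma>\<^sup>2 * (w t) ^ 3) (at t within T)" .
qed

section \<open>Jacobi elliptic functions\<close>

lemma elliptic_radicand_pos:
  fixes \<kappa> \<phi> :: real
  assumes "\<kappa>\<^sup>2 < 1"
  shows "0 < 1 - \<kappa>\<^sup>2 * (sin \<phi>)\<^sup>2"
proof -
  have "\<kappa>\<^sup>2 * (sin \<phi>)\<^sup>2 \<le> \<kappa>\<^sup>2 * 1"
    by (rule mult_left_mono) (simp_all add: abs_square_le_1)
  then show ?thesis using assms by simp
qed

lemma elliptic_F_deriv:
  assumes "\<kappa>\<^sup>2 < 1"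
  shows "(elliptic_F \<kappa> has_real_derivative 1 / sqrt (1 - \<kappa>\<^sup>2 * (sin \<phi>)\<^sup>2)) (at \<phi>)"
proof -
  \<comment> \<open>The margin 1 puts both 0 and \<phi> in the interior of \<open>{- b..b}\<close>,
    so the derivative within that interval is a two-sided one.\<close>
  define b where "b = \<bar>\<phi>\<bar> + 1"
  have b: "- b < \<phi>" "\<phi> < b" "0 < b" by (auto simp: b_def)
  have nz: "sqrt (1 - \<kappa>\<^sup>2 * (sin \<theta>)\<^sup>2) \<noteq> 0" for \<theta>
    using elliptic_radicand_pos[OF assms, of \<theta>] by simp
  have "continuous_on {- b..b} (\<lambda>\<theta>. 1 / sqrt (1 - \<kappa>\<^sup>2 * (sin \<theta>)\<^sup>2))"
    by (intro continuous_intros ballI nz)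
  from interval_integral_FTC2[OF _ _ this, of 0 \<phi>] b
  have "(elliptic_F \<kappa> has_vector_derivative 1 / sqrt (1 - \<kappa>\<^sup>2 * (sin \<phi>)\<^sup>2)) (at \<phi> within {- b..b})"
    by (simp add: elliptic_F_def[abs_def] zero_ereal_def)
  then show ?thesis
    using b by (simp add: at_within_Icc_at has_real_derivative_iff_has_vector_derivative)
qed

lemma elliptic_F_0: "elliptic_F \<kappa> 0 = 0"
  by (simp add: elliptic_F_def)

text \<open>The integrand is at least 1, so \<open>elliptic_F\<close> minus the identity is
  nondecreasing. Injectivity follows at once, and surjectivity by the intermediate value theorem on
  \<open>{- \<bar>u\<bar>..\<bar>u\<bar>}\<close>.\<close>

lemma elliptic_F_diff_ge:
  assumes "\<kappa>\<^sup>2 < 1" "a \<le> b"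
  shows "b - a \<le> elliptic_F \<kappa> b - elliptic_F \<kappa> a"
proof -
  have "elliptic_F \<kappa> a - a \<le> elliptic_F \<kappa> b - b"
  proof (rule DERIV_nonneg_imp_nondecreasing[OF assms(2)])
    fix x
    define r where "r = sqrt (1 - \<kappa>\<^sup>2 * (sin x)\<^sup>2)"
    have "0 < r" "r \<le> 1"
      using elliptic_radicand_pos[OF assms(1), of x] by (auto simp: r_def)
    then have "0 \<le> 1 / r - 1" by simp
    moreover have "((\<lambda>x. elliptic_F \<kappa> x - x) has_real_derivative 1 / r - 1) (at x)"
      unfolding r_def by (intro DERIV_diff elliptic_F_deriv[OF assms(1)] DERIV_ident)
    ultimately show "\<exists>y. ((\<lambda>x. elliptic_F \<kappa> x - x) has_real_derivative y) (at x) \<and> 0 \<le> y"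
      by blast
  qed
  then show ?thesis by simp
qed

lemma elliptic_F_inj:
  assumes "\<kappa>\<^sup>2 < 1"
  shows "inj (elliptic_F \<kappa>)"
proof (rule injI)
  fix a b assume "elliptic_F \<kappa> a = elliptic_F \<kappa> b"
  then show "a = b"
    using elliptic_F_diff_ge[OF assms, of a b] elliptic_F_diff_ge[OF assms, of b a] by linarith
qed

lemma elliptic_F_surj:
  assumes "\<kappa>\<^sup>2 < 1"
  shows "surj (elliptic_F \<kappa>)"
proof (rule surjI)
  fix u
  have "elliptic_F \<kappa> (- \<bar>u\<bar>) \<le> u" "u \<le> elliptic_F \<kappa> \<bar>u\<bar>"
    using elliptic_F_diff_ge[OF assms, of 0 "\<bar>u\<bar>"] elliptic_F_diff_ge[OF assms, of "- \<bar>u\<bar>" 0]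
    by (simp_all add: elliptic_F_0)
  moreover have "continuous_on {- \<bar>u\<bar>..\<bar>u\<bar>} (elliptic_F \<kappa>)"
    by (rule DERIV_continuous_on, rule DERIV_subset[OF elliptic_F_deriv[OF assms]]) simp
  ultimately obtain x where "elliptic_F \<kappa> x = u"
    using IVT'[of "elliptic_F \<kappa>" "- \<bar>u\<bar>" u "\<bar>u\<bar>"] by auto
  then show "elliptic_F \<kappa> (inv (elliptic_F \<kappa>) u) = u"
    by (metis f_inv_into_f rangeI)
qed

section \<open>The amplitude as inverse function, and its derivatives\<close>

lemma jacobi_am_elliptic_F:
  assumes "\<kappa>\<^sup>2 < 1"
  shows "jacobi_am (elliptic_F \<kappa> \<phi>) \<kappa> = \<phi>"
  unfolding jacobi_am_def using elliptic_F_inj[OF assms] by (auto simp: inj_eq)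

lemma elliptic_F_jacobi_am:
  assumes "\<kappa>\<^sup>2 < 1"
  shows "elliptic_F \<kappa> (jacobi_am u \<kappa>) = u"
  using elliptic_F_surj[OF assms] jacobi_am_elliptic_F[OF assms] by (metis surjD)

lemma jacobi_am_0: "\<kappa>\<^sup>2 < 1 \<Longrightarrow> jacobi_am 0 \<kappa> = 0"
  using jacobi_am_elliptic_F[of \<kappa> 0] by (simp add: elliptic_F_0)

text \<open>Inverse function rule: the reciprocal of the integrand, taken at the amplitude, is
  \<open>jacobi_dn\<close>.\<close>

lemma jacobi_am_deriv:
  assumes "\<kappa>\<^sup>2 < 1"
  shows "((\<lambda>u. jacobi_am u \<kappa>) has_real_derivative jacobi_dn u \<kappa>) (at u)"
proof -
  define \<phi> where "\<phi> = jacobi_am u \<kappa>"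
  have "isCont (\<lambda>u. jacobi_am u \<kappa>) (elliptic_F \<kappa> \<phi>)"
    by (rule isCont_inverse_function[of 1])
      (simp_all add: jacobi_am_elliptic_F[OF assms] DERIV_isCont[OF elliptic_F_deriv[OF assms]])
  then have cont: "isCont (\<lambda>u. jacobi_am u \<kappa>) u"
    by (simp add: \<phi>_def elliptic_F_jacobi_am[OF assms])
  have "1 / sqrt (1 - \<kappa>\<^sup>2 * (sin \<phi>)\<^sup>2) \<noteq> 0"
    using elliptic_radicand_pos[OF assms, of \<phi>] by simp
  from DERIV_inverse_function[OF elliptic_F_deriv[OF assms, of "jacobi_am u \<kappa>"]
      this[unfolded \<phi>_def] _ _ elliptic_F_jacobi_am[OF assms] cont, of "u - 1" "u + 1"]
  show ?thesis by (simp add: jacobi_dn_def)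
qed

lemma jacobi_dn_sq:
  "\<kappa>\<^sup>2 < 1 \<Longrightarrow> (jacobi_dn u \<kappa>)\<^sup>2 = 1 - \<kappa>\<^sup>2 * (sin (jacobi_am u \<kappa>))\<^sup>2"
  using elliptic_radicand_pos[of \<kappa> "jacobi_am u \<kappa>"] by (simp add: jacobi_dn_def)

lemma jacobi_dn_deriv:
  assumes "\<kappa>\<^sup>2 < 1"
  shows "((\<lambda>u. jacobi_dn u \<kappa>) has_real_derivative
    - \<kappa>\<^sup>2 * sin (jacobi_am u \<kappa>) * cos (jacobi_am u \<kappa>)) (at u)"
proof -
  define r where "r = 1 - \<kappa>\<^sup>2 * (sin (jacobi_am u \<kappa>))\<^sup>2"
  have r: "0 < r"
    unfolding r_def by (rule elliptic_radicand_pos[OF assms])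
  have "((\<lambda>u. 1 - \<kappa>\<^sup>2 * (sin (jacobi_am u \<kappa>))\<^sup>2) has_real_derivative
      - \<kappa>\<^sup>2 * (2 * sin (jacobi_am u \<kappa>) * (cos (jacobi_am u \<kappa>) * sqrt r))) (at u)"
    using jacobi_am_deriv[OF assms, of u]
    by (auto intro!: derivative_eq_intros simp: jacobi_dn_def r_def)
  from DERIV_chain2[OF DERIV_real_sqrt[OF r, unfolded r_def] this]
  show ?thesis
    unfolding jacobi_dn_def by (rule DERIV_cong) (use r in \<open>simp add: r_def[symmetric] field_simps\<close>)
qed

section \<open>Explicit solutions of the inversion equation in the three regimes\<close>

lemma jacobi_cn_ode:
  fixes \<Omega> \<sigma> :: real
  assumes "0 \<le> \<sigma>" "\<sigma> < \<Omega>"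
  defines "W \<equiv> \<lambda>t. - jacobi_cn (\<Omega> * t) (\<sigma> / \<Omega>)"
  shows "\<exists>W'. W' 0 = 0 \<and> (\<forall>t. (W has_real_derivative W' t) (at t) \<and>
    (W' has_real_derivative (2 * \<sigma>\<^sup>2 - \<Omega>\<^sup>2) * W t - 2 * \<sigma>\<^sup>2 * (W t) ^ 3) (at t))"
proof -
  define \<kappa> where "\<kappa> = \<sigma> / \<Omega>"
  have \<kappa>: "\<kappa>\<^sup>2 < 1"
    using assms by (simp add: \<kappa>_def power_divide power_strict_mono)
  have \<sigma>: "\<sigma> = \<kappa> * \<Omega>" using assms by (simp add: \<kappa>_def)
  define \<phi> where "\<phi> = (\<lambda>t. jacobi_am (\<Omega> * t) \<kappa>)"
  define \<Delta> where "\<Delta> = (\<lambda>t. jacobi_dn (\<Omega> * t) \<kappa>)"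
  have \<Delta>sq: "(\<Delta> t)\<^sup>2 = 1 - \<kappa>\<^sup>2 * (sin (\<phi> t))\<^sup>2" for t
    by (simp add: \<Delta>_def \<phi>_def jacobi_dn_sq[OF \<kappa>])
  have d\<phi>: "(\<phi> has_real_derivative \<Omega> * \<Delta> t) (at t)" for t
    unfolding \<phi>_def \<Delta>_def
    by (rule DERIV_cong[OF DERIV_chain2[OF jacobi_am_deriv[OF \<kappa>]]])
      (auto intro!: derivative_eq_intros)
  have d\<Delta>: "(\<Delta> has_real_derivative - \<Omega> * \<kappa>\<^sup>2 * sin (\<phi> t) * cos (\<phi> t)) (at t)" for t
    unfolding \<phi>_def \<Delta>_def
    by (rule DERIV_cong[OF DERIV_chain2[OF jacobi_dn_deriv[OF \<kappa>]]])
      (auto intro!: derivative_eq_intros)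
  have W: "W = (\<lambda>t. - cos (\<phi> t))"
    by (simp add: W_def \<phi>_def jacobi_cn_def \<kappa>_def)
  have "(W has_real_derivative \<Omega> * sin (\<phi> t) * \<Delta> t) (at t)" for t
    unfolding W by (auto intro!: derivative_eq_intros d\<phi>)
  moreover have "((\<lambda>t. \<Omega> * sin (\<phi> t) * \<Delta> t) has_real_derivative
      (2 * \<sigma>\<^sup>2 - \<Omega>\<^sup>2) * W t - 2 * \<sigma>\<^sup>2 * (W t) ^ 3) (at t)" for t
  proof -
    \<comment> \<open>The left side is the product rule applied to \<Omega> sin \<phi> \<Delta>.
      Eliminating \<Delta>^2 and sin^2 leaves a cubic in cos \<phi> = -W, with \<sigma> = \<kappa>
      \<Omega> matching the coefficients.\<close>
    have "\<Omega> * (cos (\<phi> t) * (\<Omega> * \<Delta> t)) * \<Delta> t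
        + \<Omega> * sin (\<phi> t) * (- \<Omega> * \<kappa>\<^sup>2 * sin (\<phi> t) * cos (\<phi> t))
        = \<Omega>\<^sup>2 * cos (\<phi> t) * ((\<Delta> t)\<^sup>2 - \<kappa>\<^sup>2 * (sin (\<phi> t))\<^sup>2)"
      by (simp add: power2_eq_square algebra_simps)
    also have "\<dots> = (2 * \<sigma>\<^sup>2 - \<Omega>\<^sup>2) * W t - 2 * \<sigma>\<^sup>2 * (W t) ^ 3"
      unfolding \<Delta>sq sin_squared_eq W \<sigma>
      by (simp add: power2_eq_square power3_eq_cube algebra_simps)
    finally show ?thesis
      by (auto intro!: derivative_eq_intros d\<phi> d\<Delta> simp: algebra_simps)
  qed
  moreover have "\<phi> 0 = 0"
    by (simp add: \<phi>_def jacobi_am_0[OF \<kappa>])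
  ultimately show ?thesis
    by (intro exI[of _ "\<lambda>t. \<Omega> * sin (\<phi> t) * \<Delta> t"]) simp
qed

lemma jacobi_dn_ode:
  fixes \<Omega> \<sigma> :: real
  assumes "0 \<le> \<Omega>" "\<Omega> < \<sigma>"
  defines "W \<equiv> \<lambda>t. - jacobi_dn (\<sigma> * t) (\<Omega> / \<sigma>)"
  shows "\<exists>W'. W' 0 = 0 \<and> (\<forall>t. (W has_real_derivative W' t) (at t) \<and>
    (W' has_real_derivative (2 * \<sigma>\<^sup>2 - \<Omega>\<^sup>2) * W t - 2 * \<sigma>\<^sup>2 * (W t) ^ 3) (at t))"
proof -
  define \<kappa> where "\<kappa> = \<Omega> / \<sigma>"
  have \<kappa>: "\<kappa>\<^sup>2 < 1"
    using assms by (simp add: \<kappa>_def power_divide power_strict_mono)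
  have \<Omega>: "\<Omega> = \<kappa> * \<sigma>" using assms by (simp add: \<kappa>_def)
  define \<phi> where "\<phi> = (\<lambda>t. jacobi_am (\<sigma> * t) \<kappa>)"
  define \<Delta> where "\<Delta> = (\<lambda>t. jacobi_dn (\<sigma> * t) \<kappa>)"
  have \<Delta>sq: "(\<Delta> t)\<^sup>2 = 1 - \<kappa>\<^sup>2 * (sin (\<phi> t))\<^sup>2" for t
    by (simp add: \<Delta>_def \<phi>_def jacobi_dn_sq[OF \<kappa>])
  have d\<phi>: "(\<phi> has_real_derivative \<sigma> * \<Delta> t) (at t)" for t
    unfolding \<phi>_def \<Delta>_def
    by (rule DERIV_cong[OF DERIV_chain2[OF jacobi_am_deriv[OF \<kappa>]]])
      (auto intro!: derivative_eq_intros)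
  have d\<Delta>: "(\<Delta> has_real_derivative - \<sigma> * \<kappa>\<^sup>2 * sin (\<phi> t) * cos (\<phi> t)) (at t)" for t
    unfolding \<phi>_def \<Delta>_def
    by (rule DERIV_cong[OF DERIV_chain2[OF jacobi_dn_deriv[OF \<kappa>]]])
      (auto intro!: derivative_eq_intros)
  have W: "W = (\<lambda>t. - \<Delta> t)"
    by (simp add: W_def \<Delta>_def \<kappa>_def)
  have "(W has_real_derivative \<sigma> * \<kappa>\<^sup>2 * sin (\<phi> t) * cos (\<phi> t)) (at t)" for t
    unfolding W by (auto intro!: derivative_eq_intros d\<Delta>)
  moreover have "((\<lambda>t. \<sigma> * \<kappa>\<^sup>2 * sin (\<phi> t) * cos (\<phi> t)) has_real_derivative
      (2 * \<sigma>\<^sup>2 - \<Omega>\<^sup>2) * W t - 2 * \<sigma>\<^sup>2 * (W t) ^ 3) (at t)" for t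
  proof -
    \<comment> \<open>Here W = -\<Delta>, so the cubic is rewritten first: 2 \<Delta>^2 + \<kappa>^2
      - 2 = \<kappa>^2 (cos^2 - sin^2), which is what differentiating sin \<phi> cos \<phi>
      produces.\<close>
    have "(2 * \<sigma>\<^sup>2 - \<Omega>\<^sup>2) * W t - 2 * \<sigma>\<^sup>2 * (W t) ^ 3
        = \<sigma>\<^sup>2 * \<Delta> t * (2 * (\<Delta> t)\<^sup>2 + \<kappa>\<^sup>2 - 2)"
      by (simp add: W \<Omega> power2_eq_square power3_eq_cube algebra_simps)
    also have "\<dots> = \<sigma>\<^sup>2 * \<Delta> t * (\<kappa>\<^sup>2 * ((cos (\<phi> t))\<^sup>2 - (sin (\<phi> t))\<^sup>2))"
      unfolding \<Delta>sq cos_squared_eq by (simp add: algebra_simps)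
    also have "\<dots> = \<sigma> * \<kappa>\<^sup>2 * (cos (\<phi> t) * (\<sigma> * \<Delta> t)) * cos (\<phi> t)
        + \<sigma> * \<kappa>\<^sup>2 * sin (\<phi> t) * (- sin (\<phi> t) * (\<sigma> * \<Delta> t))"
      by (simp add: power2_eq_square algebra_simps)
    finally show ?thesis
      by (auto intro!: derivative_eq_intros d\<phi>)
  qed
  moreover have "\<phi> 0 = 0"
    by (simp add: \<phi>_def jacobi_am_0[OF \<kappa>])
  ultimately show ?thesis
    by (intro exI[of _ "\<lambda>t. \<sigma> * \<kappa>\<^sup>2 * sin (\<phi> t) * cos (\<phi> t)"]) simp
qed

text \<open>The borderline \<Omega> = \<sigma> corresponds to modulus 1, outside the range
  \<open>\<kappa>\<^sup>2 < 1\<close> of the lemmas on the amplitude, so hyperbolic functions are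
  used directly. The coefficient is left unsimplified to match the general equation with \<sigma> =
  \<Omega>.\<close>

lemma sech_ode:
  fixes \<Omega> :: real
  defines "W \<equiv> \<lambda>t. - (1 / cosh (\<Omega> * t))"
  shows "\<exists>W'. W' 0 = 0 \<and> (\<forall>t. (W has_real_derivative W' t) (at t) \<and>
    (W' has_real_derivative (2 * \<Omega>\<^sup>2 - \<Omega>\<^sup>2) * W t - 2 * \<Omega>\<^sup>2 * (W t) ^ 3) (at t))"
proof -
  define c s where "c = (\<lambda>t. cosh (\<Omega> * t))" and "s = (\<lambda>t. sinh (\<Omega> * t))"
  have dc: "(c has_real_derivative \<Omega> * s t) (at t)"
    and ds: "(s has_real_derivative \<Omega> * c t) (at t)" for t
    unfolding c_def s_def by (auto intro!: derivative_eq_intros)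
  have c: "c t \<noteq> 0" for t by (simp add: c_def)
  have s2: "s t * s t = c t * c t - 1" for t
    using hyperbolic_pythagoras[of "\<Omega> * t"] by (simp add: c_def s_def power2_eq_square)
  have W: "W = (\<lambda>t. - (1 / c t))" by (simp add: W_def c_def)
  have "(W has_real_derivative \<Omega> * s t / (c t)\<^sup>2) (at t)" for t
    unfolding W by (auto intro!: derivative_eq_intros dc c simp: power2_eq_square)
  moreover have "((\<lambda>t. \<Omega> * s t / (c t)\<^sup>2) has_real_derivative
      (2 * \<Omega>\<^sup>2 - \<Omega>\<^sup>2) * W t - 2 * \<Omega>\<^sup>2 * (W t) ^ 3) (at t)" for t
  proof -
    have "\<Omega>\<^sup>2 * (c t * c t - 2 * (s t * s t)) / (c t) ^ 3 =
        (2 * \<Omega>\<^sup>2 - \<Omega>\<^sup>2) * W t - 2 * \<Omega>\<^sup>2 * (W t) ^ 3"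
      unfolding s2 using c[of t] by (simp add: W field_simps power3_eq_cube)
    moreover have "((\<lambda>t. \<Omega> * s t / (c t)\<^sup>2) has_real_derivative
        \<Omega>\<^sup>2 * (c t * c t - 2 * (s t * s t)) / (c t) ^ 3) (at t)"
      using c[of t]
      by (auto intro!: derivative_eq_intros dc ds)
        (simp add: field_simps power2_eq_square power3_eq_cube power4_eq_xxxx)
    ultimately show ?thesis by simp
  qed
  moreover have "s 0 = 0" by (simp add: s_def)
  ultimately show ?thesis
    by (intro exI[of _ "\<lambda>t. \<Omega> * s t / (c t)\<^sup>2"]) simp
qed

section \<open>Uniqueness for second order equations\<close>

text \<open>For t \<ge> 0 the function exp(-C s) D(s) does not increase away from 0, and for t \<le>
  0 the function exp(C s) D(s) does not decrease towards 0; both vanish at 0. Working on the compact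
  interval between 0 and t allows \<open>T\<close> to be any kind of interval.\<close>

lemma gronwall_zero:
  fixes D D' :: "real \<Rightarrow> real"
  assumes T: "is_interval T" "0 \<in> T"
    and D: "\<And>t. t \<in> T \<Longrightarrow> (D has_real_derivative D' t) (at t within T)"
    and bound: "\<And>t. t \<in> T \<Longrightarrow> \<bar>D' t\<bar> \<le> C * D t"
    and "D 0 = 0" and nonneg: "\<And>t. t \<in> T \<Longrightarrow> 0 \<le> D t" and t: "t \<in> T"
  shows "D t = 0"
proof -
  have E: "((\<lambda>s. exp (c * s) * D s) has_real_derivative exp (c * s) * (c * D s + D' s)) (at s within {a..b})"
    if "{a..b} \<subseteq> T" "s \<in> {a..b}" for a b c s
  proof -
    have D: "(D has_real_derivative D' s) (at s within {a..b})"
      using that by (intro DERIV_subset[OF D]) auto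
    show ?thesis
      by (rule derivative_eq_intros D refl)+ (simp add: algebra_simps)
  qed
  have sub: "{a..b} \<subseteq> T" if "a \<in> T" "b \<in> T" for a b
    using mem_is_interval_1_I[OF T(1) that] by auto
  have pos: "D t \<le> 0" if "0 \<le> t"
  proof -
    have sT: "{0..t} \<subseteq> T" by (rule sub[OF T(2) t])
    have "exp (- C * t) * D t \<le> exp (- C * 0) * D 0"
    proof (rule DERIV_nonpos_imp_decreasing_open[OF that])
      fix s assume s: "0 < s" "s < t"
      then have "s \<in> T" using sT by auto
      then have "- C * D s + D' s \<le> 0"
        using bound[of s] by linarith
      then show "\<exists>y. ((\<lambda>s. exp (- C * s) * D s) has_real_derivative y) (at s) \<and> y \<le> 0"
        using E[OF sT, of s "- C"] s
        by (intro exI[of _ "exp (- C * s) * (- C * D s + D' s)"])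
          (simp add: at_within_Icc_at mult_nonneg_nonpos)
    next
      show "continuous_on {0..t} (\<lambda>s. exp (- C * s) * D s)"
        by (rule DERIV_continuous_on[OF E[OF sT]])
    qed
    then show ?thesis using \<open>D 0 = 0\<close> by (simp add: mult_le_0_iff)
  qed
  have neg: "D t \<le> 0" if "t \<le> 0"
  proof -
    have sT: "{t..0} \<subseteq> T" by (rule sub[OF t T(2)])
    have "exp (C * t) * D t \<le> exp (C * 0) * D 0"
    proof (rule DERIV_nonneg_imp_increasing_open[OF that])
      fix s assume s: "t < s" "s < 0"
      then have "s \<in> T" using sT by auto
      then have "0 \<le> C * D s + D' s"
        using bound[of s] by linarith
      then show "\<exists>y. ((\<lambda>s. exp (C * s) * D s) has_real_derivative y) (at s) \<and> 0 \<le> y"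
        using E[OF sT, of s C] s
        by (intro exI[of _ "exp (C * s) * (C * D s + D' s)"]) (simp add: at_within_Icc_at)
    next
      show "continuous_on {t..0} (\<lambda>s. exp (C * s) * D s)"
        by (rule DERIV_continuous_on[OF E[OF sT]])
    qed
    then show ?thesis using \<open>D 0 = 0\<close> by (simp add: mult_le_0_iff)
  qed
  show ?thesis
    using pos neg nonneg[OF t] by linarith
qed

text \<open>Gronwall for the squared distance in the phase plane of position and velocity; the
  Lipschitz bound and 2 u v \<le> u^2 + v^2 give the constant \<open>1 + L\<close>. The set
  \<open>S\<close> accommodates right-hand sides, such as a cubic, that are Lipschitz only on a
  bounded range.\<close>

lemma second_order_ode_unique:
  fixes f x x' y y' :: "real \<Rightarrow> real"
  assumes T: "is_interval T" "0 \<in> T" and f: "L-lipschitz_on S f"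
    and x: "\<And>t. t \<in> T \<Longrightarrow> (x has_real_derivative x' t) (at t within T)"
      "\<And>t. t \<in> T \<Longrightarrow> (x' has_real_derivative f (x t)) (at t within T)"
    and y: "\<And>t. t \<in> T \<Longrightarrow> (y has_real_derivative y' t) (at t within T)"
      "\<And>t. t \<in> T \<Longrightarrow> (y' has_real_derivative f (y t)) (at t within T)"
    and S: "\<And>t. t \<in> T \<Longrightarrow> x t \<in> S" "\<And>t. t \<in> T \<Longrightarrow> y t \<in> S"
    and init: "x 0 = y 0" "x' 0 = y' 0" and t: "t \<in> T"
  shows "x t = y t"
proof -
  define D where "D = (\<lambda>t. (x t - y t)\<^sup>2 + (x' t - y' t)\<^sup>2)"
  define D' where "D' = (\<lambda>t. 2 * (x' t - y' t) * ((x t - y t) + (f (x t) - f (y t))))"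
  have "D t = 0"
  proof (rule gronwall_zero[OF T _ _ _ _ t])
    fix s assume s: "s \<in> T"
    show "(D has_real_derivative D' s) (at s within T)"
      unfolding D_def D'_def
      by (rule derivative_eq_intros x[OF s] y[OF s] refl)+ (simp add: algebra_simps)
    have L: "0 \<le> L" using lipschitz_on_nonneg[OF f] .
    have "\<bar>f (x s) - f (y s)\<bar> \<le> L * \<bar>x s - y s\<bar>"
      using lipschitz_onD[OF f S(1)[OF s] S(2)[OF s]] by (simp add: dist_real_def)
    then have "\<bar>(x s - y s) + (f (x s) - f (y s))\<bar> \<le> (1 + L) * \<bar>x s - y s\<bar>"
      by (simp add: algebra_simps)
    then have "\<bar>D' s\<bar> \<le> 2 * \<bar>x' s - y' s\<bar> * ((1 + L) * \<bar>x s - y s\<bar>)"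
      unfolding D'_def abs_mult by (intro mult_mono) auto
    also have "\<dots> = (1 + L) * (2 * \<bar>x s - y s\<bar> * \<bar>x' s - y' s\<bar>)"
      by simp
    also have "\<dots> \<le> (1 + L) * D s"
      using sum_squares_bound[of "\<bar>x s - y s\<bar>" "\<bar>x' s - y' s\<bar>"] L
      unfolding D_def by (intro mult_left_mono) simp_all
    finally show "\<bar>D' s\<bar> \<le> (1 + L) * D s" .
    show "0 \<le> D s" by (simp add: D_def)
  qed (simp add: D_def init)
  then show ?thesis by (simp add: D_def sum_power2_eq_zero_iff)
qed

text \<open>x^3 - y^3 = (x - y)(x^2 + x y + y^2), and the second factor is at most 3 in modulus on
  the range of possible inversions.\<close>

lemma cubic_lipschitz:
  fixes a b :: real
  shows "(\<bar>a\<bar> + 3 * \<bar>b\<bar>)-lipschitz_on {-1..1} (\<lambda>x. a * x - b * x ^ 3)"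
proof (rule lipschitz_onI)
  fix x y :: real assume xy: "x \<in> {-1..1}" "y \<in> {-1..1}"
  have "\<bar>x\<^sup>2 + x * y + y\<^sup>2\<bar> \<le> \<bar>x\<^sup>2\<bar> + \<bar>x * y\<bar> + \<bar>y\<^sup>2\<bar>" by linarith
  also have "\<dots> \<le> 1 + 1 + 1"
    using xy by (intro add_mono) (auto simp: abs_mult abs_square_le_1 mult_le_one)
  finally have *: "\<bar>x\<^sup>2 + x * y + y\<^sup>2\<bar> \<le> 3" by simp
  have "a * x - b * x ^ 3 - (a * y - b * y ^ 3) = (a - b * (x\<^sup>2 + x * y + y\<^sup>2)) * (x - y)"
    by (simp add: algebra_simps power2_eq_square power3_eq_cube)
  then have "dist (a * x - b * x ^ 3) (a * y - b * y ^ 3)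
      = \<bar>a - b * (x\<^sup>2 + x * y + y\<^sup>2)\<bar> * dist x y"
    by (simp add: dist_real_def abs_mult)
  also have "\<bar>a - b * (x\<^sup>2 + x * y + y\<^sup>2)\<bar> \<le> \<bar>a\<bar> + \<bar>b\<bar> * \<bar>x\<^sup>2 + x * y + y\<^sup>2\<bar>"
    by (metis abs_mult abs_triangle_ineq4)
  also have "\<dots> \<le> \<bar>a\<bar> + \<bar>b\<bar> * 3"
    using * by (intro add_left_mono mult_left_mono) auto
  finally show "dist (a * x - b * x ^ 3) (a * y - b * y ^ 3) \<le> (\<bar>a\<bar> + 3 * \<bar>b\<bar>) * dist x y"
    by (simp add: mult_right_mono mult.commute)
qed simp

section \<open>The atomic inversion\<close>

text \<open>The support condition concerns the left argument, so \<open>X\<close> may be the image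
  of the state under any operator.\<close>

lemma braket_two_components:
  assumes K: "K \<ge> 2"
    and supp: "\<And>k m. k \<in> {1..K} \<Longrightarrow> (k, m) \<notin> {(1, n), (2, n')} \<Longrightarrow> \<phi> k m = 0"
  shows "braket K \<phi> X = cnj (\<phi> 1 n) * X 1 n + cnj (\<phi> 2 n') * X 2 n'"
proof -
  have "braket K \<phi> X = (\<Sum>k\<in>{1, 2}. \<Sum>\<^sub>\<infinity>m. cnj (\<phi> k m) * X k m)"
    unfolding braket_def using K by (intro sum.mono_neutral_right) (auto simp: supp)
  moreover have "(\<Sum>\<^sub>\<infinity>m. cnj (\<phi> 1 m) * X 1 m) = cnj (\<phi> 1 n) * X 1 n"
    using K by (intro infsumI has_sum_finite_neutralI[of "{n}"]) (auto simp: supp)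
  moreover have "(\<Sum>\<^sub>\<infinity>m. cnj (\<phi> 2 m) * X 2 m) = cnj (\<phi> 2 n') * X 2 n'"
    using K by (intro infsumI has_sum_finite_neutralI[of "{n'}"]) (auto simp: supp)
  ultimately show ?thesis by simp
qed

theorem mainTheorem2:
  fixes K n :: nat and hb \<omega>f q \<Omega> \<sigma> :: real and \<omega> \<epsilon> :: "nat \<Rightarrow> real"
    and T :: "real set" and \<psi> :: "real \<Rightarrow> nat \<Rightarrow> nat \<Rightarrow> complex" and w :: "real \<Rightarrow> real"
  assumes "K \<ge> 2" and "hb > 0" and "q > 0"
    and "hb * (\<omega> 2 - \<omega> 1 - \<omega>f) + (\<epsilon> 2)\<^sup>2 - (\<epsilon> 1)\<^sup>2 = 0"
    and "n \<ge> 1"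
    and "is_interval T" and "0 \<in> T"
    and "NLSE_solution K hb \<omega> \<omega>f q \<epsilon> T \<psi>"
    and "braket K (\<psi> 0) (\<psi> 0) = 1"
    and "\<forall>k\<in>{1..K}. \<forall>m. \<psi> 0 k m \<noteq> 0 \<longleftrightarrow> k = 1 \<and> m = n"
    and "w = (\<lambda>t. inversion K (\<psi> t))"
    and "\<Omega> = q * sqrt (real n)"
    and "\<sigma> = (\<epsilon> 2 - \<epsilon> 1)\<^sup>2 / (2 * hb)"
  shows "(\<exists>w'. \<forall>t\<in>T.
             (w has_real_derivative w' t) (at t within T) \<and>
             (w' has_real_derivative ((2 * \<sigma>\<^sup>2 - \<Omega>\<^sup>2) * w t - 2 * \<sigma>\<^sup>2 * (w t) ^ 3)) (at t within T))
       \<and> (\<forall>t\<in>T. w t = (if \<Omega> > \<sigma> then - jacobi_cn (\<Omega> * t) (\<sigma> / \<Omega>)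
                        else if \<Omega> = \<sigma> then - (1 / cosh (\<Omega> * t))
                        else - jacobi_dn (\<sigma> * t) (\<Omega> / \<sigma>)))"
proof -
  note K = assms(1) and hb = assms(2) and T = assms(6,7) and sol = assms(8)
  have K12: "1 \<in> {1..K}" "2 \<in> {1..K}" using K by auto
  \<comment> \<open>\<open>p\<close> is the number of photons left after the atom has absorbed one
    of the \<open>n\<close>.\<close>
  obtain p where n: "n = Suc p" using assms(5) by (cases n) auto
  have init: "\<psi> 0 k m = 0" if "k \<in> {1..K}" "(k, m) \<noteq> (1, n)" for k m
    using assms(10) that by auto
  have \<Omega>: "\<Omega> > 0" using assms(3,5,12) by simp
  have \<sigma>: "\<sigma> \<ge> 0" using hb by (simp add: assms(13))

  define E where "E = (\<lambda>t. mean_eps K \<epsilon> (\<psi> t))"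
  \<comment> \<open>These frequencies depend on the whole unknown state through \<open>E\<close>,
    but they are real, which suffices for norm conservation in each block.\<close>
  define \<nu> where "\<nu> = (\<lambda>k m t. \<omega> k + real m * \<omega>f + (2 * E t * \<epsilon> k - (E t)\<^sup>2) / hb)"
  have d1: "((\<lambda>s. \<psi> s 1 m) has_vector_derivative - \<i> * \<nu> 1 m t * \<psi> t 1 m
      - (q * sqrt (real m) / 2) * \<psi> t 2 (m - 1)) (at t within T)" if "t \<in> T" for m t
    using NLSE_component_deriv[where m = m, OF sol that K12(1) K hb refl] by (simp add: \<nu>_def E_def mult.assoc)
  have d2: "((\<lambda>s. \<psi> s 2 m) has_vector_derivative - \<i> * \<nu> 2 m t * \<psi> t 2 m
      + (q * sqrt (real (Suc m)) / 2) * \<psi> t 1 (Suc m)) (at t within T)" if "t \<in> T" for m t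
    using NLSE_component_deriv[where m = m, OF sol that K12(2) K hb refl] by (simp add: \<nu>_def E_def mult.assoc)
  have dk: "((\<lambda>s. \<psi> s k m) has_vector_derivative - \<i> * \<nu> k m t * \<psi> t k m) (at t within T)"
    if "t \<in> T" "k \<in> {1..K}" "k \<noteq> 1" "k \<noteq> 2" for k m t
    using NLSE_component_deriv[where m = m, OF sol that(1,2) K hb refl] that(3,4) by (simp add: \<nu>_def E_def mult.assoc)

  have block: "(cmod (\<psi> t 1 (Suc m)))\<^sup>2 + (cmod (\<psi> t 2 m))\<^sup>2
      = (cmod (\<psi> 0 1 (Suc m)))\<^sup>2 + (cmod (\<psi> 0 2 m))\<^sup>2" if t: "t \<in> T" for t m
    by (rule two_level_norm[OF T t, where A = "\<nu> 1 (Suc m)" and B = "\<nu> 2 m"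
          and c = "q * sqrt (real (Suc m)) / 2"])
      (use d1[of _ "Suc m"] d2[of _ m] in simp_all)
  \<comment> \<open>Components without a coupling partner: levels above 2, and level 1 without
    photons, where the coupling carries \<open>sqrt 0\<close>. The two-level lemma applies with
    \<open>c = 0\<close> and a zero second amplitude.\<close>
  have single: "cmod (\<psi> t k m) = cmod (\<psi> 0 k m)"
    if t: "t \<in> T" and k: "k \<in> {1..K}" "k \<noteq> 2" "k = 1 \<longrightarrow> m = 0" for t k m
  proof -
    have "((\<lambda>s. \<psi> s k m) has_vector_derivative - \<i> * \<nu> k m s * \<psi> s k m) (at s within T)"
      if "s \<in> T" for s
      using d1[OF that, of 0] dk[OF that k(1) _ k(2), of m] k(3) by (cases "k = 1") simp_all
    then have "(cmod (\<psi> t k m))\<^sup>2 + (cmod 0)\<^sup>2 = (cmod (\<psi> 0 k m))\<^sup>2 + (cmod 0)\<^sup>2"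
      by (intro two_level_norm[OF T t, where A = "\<nu> k m" and B = "\<lambda>_. 0" and c = 0]) auto
    then show ?thesis by simp
  qed
  \<comment> \<open>Every index outside the pair (1, n), (2, p) is single or lies in another block,
    whose conserved norm is initially 0.\<close>
  have supp: "\<psi> t k m = 0" if t: "t \<in> T" and k: "k \<in> {1..K}" and km: "(k, m) \<notin> {(1, n), (2, p)}" for t k m
  proof -
    consider "k = 1" "m = 0" | j where "k = 1" "m = Suc j" | "k = 2" | "k \<noteq> 1" "k \<noteq> 2"
      by (cases m) auto
    then show ?thesis
    proof cases
      case 1
      then show ?thesis using single[OF t k] init[OF k, of 0] n by simp
    next
      case 2
      then show ?thesis
        using block[OF t, of j] init[OF K12(1), of "Suc j"] init[OF K12(2), of j] km by auto
    next
      case 3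
      then show ?thesis
        using block[OF t, of m] init[OF K12(1), of "Suc m"] init[OF K12(2), of m] km n
        by (auto simp: add_nonneg_eq_0_iff)
    next
      case 4
      then show ?thesis using single[OF t k, of m] init[OF k, of m] by simp
    qed
  qed

  define a b where "a = (\<lambda>t. \<psi> t 1 n)" and "b = (\<lambda>t. \<psi> t 2 p)"
  have braket: "braket K (\<psi> t) X = cnj (a t) * X 1 n + cnj (b t) * X 2 p" if "t \<in> T" for t X
    unfolding a_def b_def using supp[OF that] by (intro braket_two_components[OF K]) auto
  have b0: "b 0 = 0" using init[OF K12(2)] by (simp add: b_def)
  \<comment> \<open>Normalization fixes only the modulus of the initial amplitude; its phase stays
    free.\<close>
  have a0: "cmod (a 0) = 1"
  proof -
    have "complex_of_real ((cmod (a 0))\<^sup>2) = 1"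
      using assms(9) unfolding braket[OF T(2)] complex_norm_square
      by (simp add: b0) (simp add: a_def mult.commute)
    then have "(cmod (a 0))\<^sup>2 = 1" by (simp only: of_real_eq_1_iff)
    then show ?thesis
      using norm_ge_zero[of "a 0"] by (simp add: power2_eq_1_iff)
  qed
  have norm: "(cmod (a t))\<^sup>2 + (cmod (b t))\<^sup>2 = 1" if "t \<in> T" for t
    using block[OF that, of p] a0 b0 by (simp add: a_def b_def n)
  have w: "w t = (cmod (b t))\<^sup>2 - (cmod (a t))\<^sup>2" if "t \<in> T" for t
    unfolding assms(11) inversion_def braket[OF that] R3_def bb_def cmod_power2
    by (simp add: a_def b_def power2_eq_square field_simps)
  have E: "E t = \<epsilon> 1 * (cmod (a t))\<^sup>2 + \<epsilon> 2 * (cmod (b t))\<^sup>2" if "t \<in> T" for t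
  proof -
    have "braket K (\<psi> t) (\<psi> t) = of_real ((cmod (a t))\<^sup>2 + (cmod (b t))\<^sup>2)"
      unfolding braket[OF that] of_real_add complex_norm_square by (simp add: a_def b_def mult.commute)
    moreover have "braket K (\<psi> t) (eps_op K \<epsilon> (\<psi> t))
        = of_real (\<epsilon> 1 * (cmod (a t))\<^sup>2 + \<epsilon> 2 * (cmod (b t))\<^sup>2)"
      unfolding braket[OF that] eps_op_eq[OF K12(1)] eps_op_eq[OF K12(2)]
        of_real_add of_real_mult complex_norm_square
      by (simp add: a_def b_def mult_ac)
    ultimately show ?thesis
      by (simp only: E_def mean_eps_def norm[OF that]) simp
  qed
  \<comment> \<open>The photon energies differ by one quantum and the \<open>E\<close> squared terms
    cancel. Since E = (\<epsilon>1 + \<epsilon>2)/2 + (\<epsilon>2 - \<epsilon>1) w/2, resonance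
    removes the constant part of the detuning and leaves (\<epsilon>2 - \<epsilon>1)^2 w /
    \<open>hb\<close>.\<close>
  have detuning: "\<nu> 2 p t - \<nu> 1 n t = 2 * \<sigma> * w t" if "t \<in> T" for t
  proof -
    have b2: "(cmod (b t))\<^sup>2 = (1 + w t) / 2" and a2: "(cmod (a t))\<^sup>2 = (1 - w t) / 2"
      using norm[OF that] w[OF that] by auto
    have "hb * (\<nu> 2 p t - \<nu> 1 n t) = hb * (\<omega> 2 - \<omega> 1 - \<omega>f) + 2 * E t * (\<epsilon> 2 - \<epsilon> 1)"
      using hb by (simp add: \<nu>_def n field_simps)
    also have "\<dots> = (\<epsilon> 1)\<^sup>2 - (\<epsilon> 2)\<^sup>2 + 2 * E t * (\<epsilon> 2 - \<epsilon> 1)"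
      using assms(4) by simp
    also have "\<dots> = (\<epsilon> 2 - \<epsilon> 1)\<^sup>2 * w t"
      unfolding E[OF that] a2 b2 by (simp add: power2_eq_square field_simps)
    also have "\<dots> = hb * (2 * \<sigma> * w t)"
      using hb by (simp add: assms(13))
    finally show ?thesis using hb by simp
  qed
  have da: "(a has_vector_derivative - \<i> * \<nu> 1 n t * a t - (\<Omega> / 2) * b t) (at t within T)"
    if "t \<in> T" for t
    using d1[OF that, of n] by (simp add: a_def b_def n assms(12))
  have db: "(b has_vector_derivative - \<i> * \<nu> 2 p t * b t + (\<Omega> / 2) * a t) (at t within T)"
    if "t \<in> T" for t
    using d2[OF that, of p] by (simp add: a_def b_def n assms(12))
  define w' where "w' = (\<lambda>t. 2 * \<Omega> * Re (cnj (a t) * b t))"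
  have ode: "(w has_real_derivative w' t) (at t within T)"
    "(w' has_real_derivative (2 * \<sigma>\<^sup>2 - \<Omega>\<^sup>2) * w t - 2 * \<sigma>\<^sup>2 * (w t) ^ 3) (at t within T)"
    if "t \<in> T" for t
    unfolding w'_def
    by (rule two_level_inversion_ode[where a = a and b = b and A = "\<nu> 1 n" and B = "\<nu> 2 p",
          OF T less_imp_neq[OF \<Omega>, symmetric] da db a0 b0 detuning w that]; assumption)+
  have w_bound: "w t \<in> {-1..1}" if "t \<in> T" for t
    using norm[OF that] w[OF that] zero_le_power2[of "cmod (a t)"] zero_le_power2[of "cmod (b t)"]
    by (simp only: atLeastAtMost_iff) linarith
  \<comment> \<open>The initial data agree: w(0) = -1, and w'(0) = 0 because \<open>b 0 = 0\<close>.
    The bound on \<open>W\<close> keeps both functions where the cubic is Lipschitz.\<close>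
  have unique: "w t = W t"
    if W: "\<exists>W'. W' 0 = 0 \<and> (\<forall>t. (W has_real_derivative W' t) (at t) \<and>
        (W' has_real_derivative (2 * \<sigma>\<^sup>2 - \<Omega>\<^sup>2) * W t - 2 * \<sigma>\<^sup>2 * (W t) ^ 3) (at t))"
      and W0: "W 0 = -1" and bound: "\<And>t. W t \<in> {-1..1}" and t: "t \<in> T" for W t
  proof -
    obtain W' where W': "W' 0 = 0" "\<And>t. (W has_real_derivative W' t) (at t)"
      "\<And>t. (W' has_real_derivative (2 * \<sigma>\<^sup>2 - \<Omega>\<^sup>2) * W t - 2 * \<sigma>\<^sup>2 * (W t) ^ 3) (at t)"
      using W by blast
    show ?thesis
    proof (rule second_order_ode_unique[where x = w and y = W, OF T cubic_lipschitz _ _ _ _ _ _ _ _ t])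
      fix s assume s: "s \<in> T"
      show "(w has_real_derivative w' s) (at s within T)"
        "(w' has_real_derivative (2 * \<sigma>\<^sup>2 - \<Omega>\<^sup>2) * w s - 2 * \<sigma>\<^sup>2 * (w s) ^ 3) (at s within T)"
        using ode[OF s] by auto
      show "(W has_real_derivative W' s) (at s within T)"
        "(W' has_real_derivative (2 * \<sigma>\<^sup>2 - \<Omega>\<^sup>2) * W s - 2 * \<sigma>\<^sup>2 * (W s) ^ 3) (at s within T)"
        using W'(2,3) by (auto intro: has_field_derivative_at_within)
      show "w s \<in> {-1..1}" "W s \<in> {-1..1}"
        using w_bound[OF s] bound by auto
    qed (use w[OF T(2)] a0 b0 W0 W'(1) in \<open>simp_all add: w'_def\<close>)
  qed
  have "w t = (if \<Omega> > \<sigma> then - jacobi_cn (\<Omega> * t) (\<sigma> / \<Omega>)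
               else if \<Omega> = \<sigma> then - (1 / cosh (\<Omega> * t))
               else - jacobi_dn (\<sigma> * t) (\<Omega> / \<sigma>))" if t: "t \<in> T" for t
  proof -
    consider "\<sigma> < \<Omega>" | "\<Omega> = \<sigma>" | "\<Omega> < \<sigma>" by linarith
    then show ?thesis
    proof cases
      case 1
      then have \<kappa>: "(\<sigma> / \<Omega>)\<^sup>2 < 1"
        using \<sigma> \<Omega> by (simp add: power_divide power_strict_mono)
      have "w t = - jacobi_cn (\<Omega> * t) (\<sigma> / \<Omega>)"
        by (rule unique[OF jacobi_cn_ode[OF \<sigma> 1] _ _ t])
          (simp_all add: jacobi_cn_def jacobi_am_0[OF \<kappa>])
      then show ?thesis using 1 by simp
    next
      case 2
      have "w t = - (1 / cosh (\<Omega> * t))"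
      proof (rule unique[OF _ _ _ t])
        show "- (1 / cosh (\<Omega> * s)) \<in> {-1..1}" for s
          using cosh_real_ge_1[of "\<Omega> * s"] by (simp add: divide_le_eq_1 order_trans[of "-1" 0])
      qed (use sech_ode[of \<Omega>] 2 in simp_all)
      then show ?thesis using 2 by simp
    next
      case 3
      then have \<kappa>: "(\<Omega> / \<sigma>)\<^sup>2 < 1"
        using \<Omega> by (simp add: power_divide power_strict_mono)
      have dn: "0 \<le> jacobi_dn u (\<Omega> / \<sigma>)" "jacobi_dn u (\<Omega> / \<sigma>) \<le> 1" for u
        using elliptic_radicand_pos[OF \<kappa>, of "jacobi_am u (\<Omega> / \<sigma>)"]
        by (simp_all add: jacobi_dn_def)
      have "w t = - jacobi_dn (\<sigma> * t) (\<Omega> / \<sigma>)"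
      proof (rule unique[OF jacobi_dn_ode _ _ t])
        show "- jacobi_dn (\<sigma> * s) (\<Omega> / \<sigma>) \<in> {-1..1}" for s
          using dn[of "\<sigma> * s"] by simp
      qed (use 3 \<Omega> in \<open>simp_all add: jacobi_dn_def jacobi_am_0[OF \<kappa>]\<close>)
      then show ?thesis using 3 by simp
    qed
  qed
  then show ?thesis
    using ode by blast
qed

end
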